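(* Let $G=(V,E,F)$ be a cellular decomposition of a topological torus $S$ and let $c:E\to\mathbb{R}$ be non-degenerate edge weights. Let $\tau\in\mathbb{H}$, let $h_\tau$ be the harmonic map to $S_\tau$ homotopic to the inclusion of the 1-skeleton (it is unique up to translation), and let $k>0$. Then the following statements are equivalent: (i) $(\tau,h_\tau)$ is the unique minimizer (unique up to translations of $h_\tau$) of $\mathcal{D}_c$, and the minimum value is $\mathcal{D}_c(\tau,h_\tau)=k$. (ii) The conjugate map of $h_\tau$ projects to $kS_\tau$.
   Context: Setting. $S$ is an oriented topological torus and $G=(V,E,F)$ is a finite cellular decomposition of $S$ (every open face is an open disk); multiple edges and loops are allowed, but a loop must be non-contractible in $S$. $\tilde G=(\tilde V,\tilde E,\tilde F)$ is the lift of $G$ to the universal cover. $\gamma_1,\gamma_2$ are generators of $\pi_1(S)$, acting on $\tilde G$ by deck transformations, ordered so that $(\gamma_1,\gamma_2)$ is positively oriented (intersection number $+1$). Edge weights are symmetric, $c_{ij}=c_{ji}$, and are lifted to $\tilde E$. Non-degeneracy. A discrete 1-form is a real function $\omega$ on oriented edges with $\omega_{ij}=-\omega_{ji}$; it is closed if its sum around the boundary of every oriented face is zero. The edge weight $c:E\to\mathbb{R}$ (values of arbitrary sign) is non-degenerate if for every closed 1-form $\omega$ one has $\frac12\sum_{ij\in E}c_{ij}\omega_{ij}^2\ge 0$, with equality if and only if $\omega\equiv0$. Euclidean tori. $\mathbb{H}\subset\mathbb{C}$ is the upper half plane. For $\tau\in\mathbb{H}$, $S_\tau$ is the unit-area quotient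 of $\mathbb{C}$ by the translations $z\mapsto z+\frac{1}{\sqrt{\mathrm{Im}\,\tau}}$ (for $\gamma_1$) and $z\mapsto z+\frac{\tau}{\sqrt{\mathrm{Im}\,\tau}}$ (for $\gamma_2$). Maps and energy. A straight-line map $h:(V,E)\to S_\tau$ homotopic to the inclusion of the 1-skeleton is given by its lift $\tilde h:\tilde V\to\mathbb{C}$ (edges mapped to straight segments) satisfying $\tilde h\circ\gamma_1=\tilde h+\frac{1}{\sqrt{\mathrm{Im}\,\tau}}$ and $\tilde h\circ\gamma_2=\tilde h+\frac{\tau}{\sqrt{\mathrm{Im}\,\tau}}$. Its Dirichlet energy is $D_c(h)=\frac12\sum_{ij\in E}c_{ij}|\tilde h_{\tilde j}-\tilde h_{\tilde i}|^2$, where $\tilde i\tilde j$ is any lift of $ij$. $\mathcal{D}_c$ is the function $(\tau,h)\mapsto D_c(h)$ on all pairs consisting of $\tau\in\mathbb{H}$ and such a map $h$ to $S_\tau$. The map $h$ is harmonic if $\sum_j c_{ij}(\tilde h_j-\tilde h_i)=0$ for all $i\in\tilde V$ (sum over edges of $\tilde E$ at $i$). Conjugate map. For a harmonic map $h$, the conjugate map $\tilde h^*:\tilde F\to\mathbb{C}$ is defined, up to an additive constant, by $\tilde h^*_{\mathrm{left}(ij)}-\tilde h^*_{\mathrm{right}(ij)}=\sqrt{-1}\,c_{ij}(\tilde h_j-\tilde h_i)$ for every oriented edge $ij$ of $\tilde G$, where $\mathrm{left}(ij),\mathrm{right}(ij)$ are the faces to its left and right. For $k>0$, "$\tilde h^*$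 projects to $kS_\tau$" means $\tilde h^*\circ\gamma_1=\tilde h^*+\frac{k}{\sqrt{\mathrm{Im}\,\tau}}$ and $\tilde h^*\circ\gamma_2=\tilde h^*+\frac{k\tau}{\sqrt{\mathrm{Im}\,\tau}}$. *)

theory Defs
  imports Complex_Main "HOL-Combinatorics.Orbits" "HOL-Algebra.Generated_Groups"
begin

(* A cellular decomposition of an oriented surface without boundary is encoded by its
   combinatorial map (rotation system).  The elements of 'd are the oriented edges (darts):
   opp reverses an oriented edge, and ccw sends an oriented edge to the next one, in
   counterclockwise order, with the same starting point.  Vertices, edges and faces are the
   cycles of ccw, opp and face_next; each face is an open disk glued in along its cycle.
   Loops, multiple edges and faces meeting themselves are allowed. *)
record 'd cmap =
  opp :: "'d \<Rightarrow> 'd"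
  ccw :: "'d \<Rightarrow> 'd"

definition combinatorial_map :: "'d cmap \<Rightarrow> bool" where
  "combinatorial_map M \<longleftrightarrow>
     bij (ccw M) \<and> (\<forall>d. opp M (opp M d) = d) \<and> (\<forall>d. opp M d \<noteq> d)"

(* The boundary of the face to the left of d continues, at the end point of d, with the first
   oriented edge clockwise from opp d. *)
definition face_next :: "'d cmap \<Rightarrow> 'd \<Rightarrow> 'd" where
  "face_next M d = inv_into UNIV (ccw M) (opp M d)"

(* A vertex is the set of oriented edges leaving it; a face is the set of oriented edges that
   have it on their left, i.e. its counterclockwise boundary. *)
definition tail :: "'d cmap \<Rightarrow> 'd \<Rightarrow> 'd set" where
  "tail M d = orbit (ccw M) d"

definition head :: "'d cmap \<Rightarrow> 'd \<Rightarrow> 'd set" where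
  "head M d = tail M (opp M d)"

definition left :: "'d cmap \<Rightarrow> 'd \<Rightarrow> 'd set" where
  "left M d = orbit (face_next M) d"

definition right :: "'d cmap \<Rightarrow> 'd \<Rightarrow> 'd set" where
  "right M d = left M (opp M d)"

definition vertices :: "'d cmap \<Rightarrow> 'd set set" where
  "vertices M = range (tail M)"

definition edges :: "'d cmap \<Rightarrow> 'd set set" where
  "edges M = range (\<lambda>d. {d, opp M d})"

definition faces :: "'d cmap \<Rightarrow> 'd set set" where
  "faces M = range (left M)"

fun is_walk :: "('d \<Rightarrow> 'x) \<Rightarrow> ('d \<Rightarrow> 'x) \<Rightarrow> 'x \<Rightarrow> 'd list \<Rightarrow> 'x \<Rightarrow> bool" where
  "is_walk s t x [] y \<longleftrightarrow> x = y"
| "is_walk s t x (d # ds) y \<longleftrightarrow> s d = x \<and> is_walk s t (t d) ds y"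

definition walk :: "'d cmap \<Rightarrow> 'd set \<Rightarrow> 'd list \<Rightarrow> 'd set \<Rightarrow> bool" where
  "walk M = is_walk (tail M) (head M)"

(* A walk in the dual graph; d stands for the dual edge crossing d from right to left. *)
definition dual_walk :: "'d cmap \<Rightarrow> 'd set \<Rightarrow> 'd list \<Rightarrow> 'd set \<Rightarrow> bool" where
  "dual_walk M = is_walk (right M) (left M)"

definition cmap_connected :: "'d cmap \<Rightarrow> bool" where
  "cmap_connected M \<longleftrightarrow> (\<forall>v\<in>vertices M. \<forall>w\<in>vertices M. \<exists>ds. walk M v ds w)"

definition face_walk :: "'d cmap \<Rightarrow> 'd \<Rightarrow> 'd list" where
  "face_walk M d = map (\<lambda>i. (face_next M ^^ i) d) [0..<card (left M d)]"

(* Homotopy, relative to the end points v and w, of walks in the surface (not just in its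
   1-skeleton): generated by removing backtracks and boundaries of faces. *)
inductive walk_homotopic :: "'d cmap \<Rightarrow> 'd set \<Rightarrow> 'd set \<Rightarrow> 'd list \<Rightarrow> 'd list \<Rightarrow> bool"
  for M v w where
  refl: "walk M v xs w \<Longrightarrow> walk_homotopic M v w xs xs"
| sym: "walk_homotopic M v w xs ys \<Longrightarrow> walk_homotopic M v w ys xs"
| trans: "walk_homotopic M v w xs ys \<Longrightarrow> walk_homotopic M v w ys zs \<Longrightarrow> walk_homotopic M v w xs zs"
| backtrack: "walk M v (xs @ [d, opp M d] @ ys) w \<Longrightarrow>
    walk_homotopic M v w (xs @ [d, opp M d] @ ys) (xs @ ys)"
| face: "walk M v (xs @ face_walk M d @ ys) w \<Longrightarrow>
    walk_homotopic M v w (xs @ face_walk M d @ ys) (xs @ ys)"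

definition cmap_simply_connected :: "'d cmap \<Rightarrow> bool" where
  "cmap_simply_connected M \<longleftrightarrow> cmap_connected M \<and>
     (\<forall>v\<in>vertices M. \<forall>ds. walk M v ds v \<longrightarrow> walk_homotopic M v v ds [])"

definition euler_char :: "'d cmap \<Rightarrow> int" where
  "euler_char M = int (card (vertices M)) - int (card (edges M)) + int (card (faces M))"

(* By the classification of surfaces, a finite connected combinatorial map (always closed and
   oriented) describes a torus iff its Euler characteristic is 0. *)
definition torus_decomposition :: "('d::finite) cmap \<Rightarrow> bool" where
  "torus_decomposition G \<longleftrightarrow>
     combinatorial_map G \<and> cmap_connected G \<and> euler_char G = 0 \<and>
     (\<forall>d. tail G d = head G d \<longrightarrow> \<not> walk_homotopic G (tail G d) (tail G d) [d] [])"

(* Injectivity on vertices and faces says that p is unramified there. *)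
definition covering_map :: "'d cmap \<Rightarrow> 'e cmap \<Rightarrow> ('e \<Rightarrow> 'd) \<Rightarrow> bool" where
  "covering_map G U p \<longleftrightarrow> surj p \<and>
     (\<forall>e. p (ccw U e) = ccw G (p e)) \<and> (\<forall>e. p (opp U e) = opp G (p e)) \<and>
     (\<forall>v\<in>vertices U. inj_on p v) \<and> (\<forall>f\<in>faces U. inj_on p f)"

definition universal_cover :: "'d cmap \<Rightarrow> 'e cmap \<Rightarrow> ('e \<Rightarrow> 'd) \<Rightarrow> bool" where
  "universal_cover G U p \<longleftrightarrow>
     combinatorial_map U \<and> covering_map G U p \<and> cmap_simply_connected U"

(* Acts on a vertex or face x by taking the image g ` x. *)
definition deck_transformation :: "'e cmap \<Rightarrow> ('e \<Rightarrow> 'd) \<Rightarrow> ('e \<Rightarrow> 'e) \<Rightarrow> bool" where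
  "deck_transformation U p g \<longleftrightarrow> bij g \<and> (\<forall>e. p (g e) = p e) \<and>
     (\<forall>e. g (ccw U e) = ccw U (g e)) \<and> (\<forall>e. g (opp U e) = opp U (g e))"

definition deck_group :: "'e cmap \<Rightarrow> ('e \<Rightarrow> 'd) \<Rightarrow> ('e \<Rightarrow> 'e) monoid" where
  "deck_group U p = \<lparr>carrier = {g. deck_transformation U p g}, mult = (\<circ>), one = id\<rparr>"

(* +1 if the dual edge of b crosses a from right to left, -1 if from left to right. *)
definition crossing :: "'d cmap \<Rightarrow> 'd \<Rightarrow> 'd \<Rightarrow> int" where
  "crossing G a b = (if a = b then 1 else if a = opp G b then -1 else 0)"

(* The algebraic intersection number of two deck transformations, viewed as closed curves on the
   surface: \<gamma>1 is represented by a closed walk in the graph and \<gamma>2 by a closed walk in the dual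
   graph, and signed crossings in the surface are counted.  The value does not depend on the
   representatives.  A crossing is positive if the direction of \<gamma>1 followed by that of \<gamma>2 is a
   positive frame, i.e. if \<gamma>2 crosses \<gamma>1 from right to left. *)
definition has_intersection_number ::
    "'d cmap \<Rightarrow> 'e cmap \<Rightarrow> ('e \<Rightarrow> 'd) \<Rightarrow> ('e \<Rightarrow> 'e) \<Rightarrow> ('e \<Rightarrow> 'e) \<Rightarrow> int \<Rightarrow> bool" where
  "has_intersection_number G U p \<gamma>1 \<gamma>2 n \<longleftrightarrow>
     (\<exists>v\<in>vertices U. \<exists>f\<in>faces U. \<exists>as bs.
        walk U v as (\<gamma>1 ` v) \<and> dual_walk U f bs (\<gamma>2 ` f) \<and>
        (\<Sum>a\<leftarrow>as. \<Sum>b\<leftarrow>bs. crossing G (p a) (p b)) = n)"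

definition positive_generators ::
    "'d cmap \<Rightarrow> 'e cmap \<Rightarrow> ('e \<Rightarrow> 'd) \<Rightarrow> ('e \<Rightarrow> 'e) \<Rightarrow> ('e \<Rightarrow> 'e) \<Rightarrow> bool" where
  "positive_generators G U p \<gamma>1 \<gamma>2 \<longleftrightarrow>
     deck_transformation U p \<gamma>1 \<and> deck_transformation U p \<gamma>2 \<and>
     generate (deck_group U p) {\<gamma>1, \<gamma>2} = carrier (deck_group U p) \<and>
     has_intersection_number G U p \<gamma>1 \<gamma>2 1"

definition edge_weight :: "'d cmap \<Rightarrow> ('d \<Rightarrow> real) \<Rightarrow> bool" where
  "edge_weight G c \<longleftrightarrow> (\<forall>d. c (opp G d) = c d)"

(* Sum over unoriented edges of a function that is invariant under opp: each edge consists of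
   two oriented edges. *)
definition edge_sum :: "('d::finite \<Rightarrow> real) \<Rightarrow> real" where
  "edge_sum f = (\<Sum>d\<in>UNIV. f d) / 2"

definition closed_1form :: "'d cmap \<Rightarrow> ('d \<Rightarrow> real) \<Rightarrow> bool" where
  "closed_1form G \<omega> \<longleftrightarrow>
     (\<forall>d. \<omega> (opp G d) = - \<omega> d) \<and> (\<forall>f\<in>faces G. (\<Sum>d\<in>f. \<omega> d) = 0)"

definition nondegenerate :: "('d::finite) cmap \<Rightarrow> ('d \<Rightarrow> real) \<Rightarrow> bool" where
  "nondegenerate G c \<longleftrightarrow> (\<forall>\<omega>. closed_1form G \<omega> \<longrightarrow>
     1/2 * edge_sum (\<lambda>d. c d * (\<omega> d)\<^sup>2) \<ge> 0 \<and>
     (1/2 * edge_sum (\<lambda>d. c d * (\<omega> d)\<^sup>2) = 0 \<longleftrightarrow> (\<forall>d. \<omega> d = 0)))"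

(* The translations of the plane that define S_\<tau>, scaled by k, as periods of a map defined on the
   set X of vertices or faces of the universal cover. *)
definition has_periods ::
    "('e \<Rightarrow> 'e) \<Rightarrow> ('e \<Rightarrow> 'e) \<Rightarrow> 'e set set \<Rightarrow> real \<Rightarrow> complex \<Rightarrow> ('e set \<Rightarrow> complex) \<Rightarrow> bool" where
  "has_periods \<gamma>1 \<gamma>2 X k \<tau> g \<longleftrightarrow> (\<forall>x\<in>X.
     g (\<gamma>1 ` x) = g x + complex_of_real k / complex_of_real (sqrt (Im \<tau>)) \<and>
     g (\<gamma>2 ` x) = g x + complex_of_real k * \<tau> / complex_of_real (sqrt (Im \<tau>)))"

(* A straight-line map to S_\<tau>, homotopic to the inclusion, is given by the values of its lift on
   the vertices of the universal cover; values off vertices U are irrelevant. *)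
definition straight_line_map ::
    "'e cmap \<Rightarrow> ('e \<Rightarrow> 'e) \<Rightarrow> ('e \<Rightarrow> 'e) \<Rightarrow> complex \<Rightarrow> ('e set \<Rightarrow> complex) \<Rightarrow> bool" where
  "straight_line_map U \<gamma>1 \<gamma>2 \<tau> h \<longleftrightarrow> has_periods \<gamma>1 \<gamma>2 (vertices U) 1 \<tau> h"

(* inv_into UNIV p d is an arbitrary lift of d; the energy does not depend on this choice. *)
definition dirichlet_energy ::
    "'e cmap \<Rightarrow> ('e \<Rightarrow> 'd::finite) \<Rightarrow> ('d \<Rightarrow> real) \<Rightarrow> ('e set \<Rightarrow> complex) \<Rightarrow> real" where
  "dirichlet_energy U p c h = 1/2 * edge_sum (\<lambda>d. c d *
     (let e = inv_into UNIV p d in (cmod (h (head U e) - h (tail U e)))\<^sup>2))"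

definition harmonic :: "'e cmap \<Rightarrow> ('e \<Rightarrow> 'd) \<Rightarrow> ('d \<Rightarrow> real) \<Rightarrow> ('e set \<Rightarrow> complex) \<Rightarrow> bool" where
  "harmonic U p c h \<longleftrightarrow>
     (\<forall>v\<in>vertices U. (\<Sum>e\<in>v. complex_of_real (c (p e)) * (h (head U e) - h v)) = 0)"

definition conjugate_map ::
    "'e cmap \<Rightarrow> ('e \<Rightarrow> 'd) \<Rightarrow> ('d \<Rightarrow> real) \<Rightarrow> ('e set \<Rightarrow> complex) \<Rightarrow> ('e set \<Rightarrow> complex) \<Rightarrow> bool" where
  "conjugate_map U p c h hc \<longleftrightarrow>
     (\<forall>e. hc (left U e) - hc (right U e) =
        \<i> * complex_of_real (c (p e)) * (h (head U e) - h (tail U e)))"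

definition projects_to ::
    "'e cmap \<Rightarrow> ('e \<Rightarrow> 'e) \<Rightarrow> ('e \<Rightarrow> 'e) \<Rightarrow> real \<Rightarrow> complex \<Rightarrow> ('e set \<Rightarrow> complex) \<Rightarrow> bool" where
  "projects_to U \<gamma>1 \<gamma>2 k \<tau> hc \<longleftrightarrow> has_periods \<gamma>1 \<gamma>2 (faces U) k \<tau> hc"

definition energy_domain ::
    "'e cmap \<Rightarrow> ('e \<Rightarrow> 'e) \<Rightarrow> ('e \<Rightarrow> 'e) \<Rightarrow> (complex \<times> ('e set \<Rightarrow> complex)) set" where
  "energy_domain U \<gamma>1 \<gamma>2 = {(\<tau>, h). Im \<tau> > 0 \<and> straight_line_map U \<gamma>1 \<gamma>2 \<tau> h}"

definition energy_minimizer ::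
    "'e cmap \<Rightarrow> ('e \<Rightarrow> 'd::finite) \<Rightarrow> ('e \<Rightarrow> 'e) \<Rightarrow> ('e \<Rightarrow> 'e) \<Rightarrow> ('d \<Rightarrow> real) \<Rightarrow>
     complex \<Rightarrow> ('e set \<Rightarrow> complex) \<Rightarrow> bool" where
  "energy_minimizer U p \<gamma>1 \<gamma>2 c \<tau> h \<longleftrightarrow>
     is_arg_min (\<lambda>(\<tau>, h). dirichlet_energy U p c h)
       (\<lambda>x. x \<in> energy_domain U \<gamma>1 \<gamma>2) (\<tau>, h)"

definition unique_energy_minimizer ::
    "'e cmap \<Rightarrow> ('e \<Rightarrow> 'd::finite) \<Rightarrow> ('e \<Rightarrow> 'e) \<Rightarrow> ('e \<Rightarrow> 'e) \<Rightarrow> ('d \<Rightarrow> real) \<Rightarrow>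
     complex \<Rightarrow> ('e set \<Rightarrow> complex) \<Rightarrow> bool" where
  "unique_energy_minimizer U p \<gamma>1 \<gamma>2 c \<tau> h \<longleftrightarrow>
     energy_minimizer U p \<gamma>1 \<gamma>2 c \<tau> h \<and>
     (\<forall>\<tau>' h'. energy_minimizer U p \<gamma>1 \<gamma>2 c \<tau>' h' \<longrightarrow>
        \<tau>' = \<tau> \<and> (\<exists>b. \<forall>v\<in>vertices U. h' v = h v + b))"

end

theory Submission
  imports Defs
begin

text \<open>
  Write \<open>u\<close> and \<open>v\<close> for the real and imaginary parts of \<open>h\<close>, and \<open>E(f, g)\<close> for the sum over the edges
  of \<open>c df dg\<close>.  Both statements of the theorem say that \<open>E(u, u) = E(v, v) = k\<close> and
  \<open>E(u, v) = 0\<close>; in words, that the energy of harmonic functions is conformal to the Euclidean metric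
  of the target torus.

  For the minimization property, subtract from a map \<open>h'\<close> to another unit-area torus the linear
  image \<open>A h\<close> of \<open>h\<close> with the same periods.  The difference is invariant under the deck group,
  hence orthogonal to the harmonic map \<open>A h\<close>, and by non-degeneracy its energy is positive unless it
  is constant.  So only the energy of \<open>A h\<close> matters, where \<open>A\<close> is a triangular matrix of determinant
  1 with positive diagonal.  If \<open>E\<close> is \<open>k\<close> times the identity, this energy is \<open>k / 2\<close> times the squared
  norm of \<open>A\<close>, whose unique minimum is at the identity; in the other direction, shears and stretches
  \<open>A\<close> detect every deviation of \<open>E\<close> from a multiple of the identity
  (\<open>unique_minimizer_if_conformal\<close>, \<open>conformal_if_minimizer\<close>).

  For the conjugate map, the link between its periods and \<open>E\<close> is the bilinear relation: for a closed
  form \<open>\<omega>\<close> on \<open>G\<close> and a closed form \<open>\<eta>\<close> on the dual of \<open>G\<close>, the sum over the edges of \<open>\<omega> \<eta>\<close> is the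
  determinant of their periods along \<open>\<gamma>1\<close> and \<open>\<gamma>2\<close> (\<open>bilinear_relation\<close>).  By summation by parts
  the left side depends only on the periods; it is alternating because a telescoping sum vanishes
  (\<open>pairing_same_periods\<close>); and the remaining factor is the intersection number of \<open>\<gamma>1\<close> and \<open>\<gamma>2\<close>,
  as one sees from the form that counts crossings with a dual walk representing \<open>\<gamma>2\<close>
  (\<open>ex_dual_form\<close>).

  All topology of the universal cover enters through one lifting principle: an unramified covering
  of a simply connected map has a section through each of its points (\<open>section_exists\<close>).  Applied to
  the fibre product of \<open>p\<close> with itself it makes the deck group transitive on fibres, so that
  invariant functions descend to \<open>G\<close>; applied to trivial line bundles it provides potentials of
  closed forms on \<open>U\<close> and on its dual.
\<close>

section \<open>Orbits of permutations\<close>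

text \<open>
  By the pigeonhole principle two iterates of \<open>x\<close> coincide, and injectivity cancels the common
  part.
\<close>

lemma mem_orbit_self:
  assumes "bij f" and "finite (orbit f x)"
  shows "x \<in> orbit f x"
proof -
  let ?g = "\<lambda>n. (f ^^ Suc n) x"
  have "range ?g \<subseteq> orbit f x"
    unfolding orbit_altdef by blast
  then have "finite (range ?g)"
    using assms(2) finite_subset by blast
  then have "\<not> inj ?g"
    using finite_imageD infinite_UNIV_nat by blast
  then obtain m n where mn: "m < n" "?g m = ?g n"
    unfolding inj_on_def by (metis linorder_neqE_nat)
  have "(f ^^ Suc m) ((f ^^ (n - m)) x) = (f ^^ (Suc m + (n - m))) x"
    by (simp only: funpow_add comp_apply)
  also have "\<dots> = (f ^^ Suc m) x"
    using mn by (simp del: funpow.simps)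
  finally have "(f ^^ (n - m)) x = x"
    using bij_is_inj[OF bij_fn[OF assms(1)]] by (rule injD[rotated])
  moreover have "n - m > 0" using mn by simp
  ultimately show ?thesis
    unfolding orbit_altdef mem_Collect_eq by metis
qed

lemma orbit_eq_if_mem:
  assumes "x \<in> orbit f x" and "y \<in> orbit f x"
  shows "orbit f y = orbit f x"
  using assms by (meson orbit_swap orbit_trans subset_antisym subsetI)

lemma card_orbit:
  assumes "x \<in> orbit f x"
  shows "card (orbit f x) = funpow_dist1 f x x"
proof -
  have "card (orbit f x) = card {0..<funpow_dist1 f x x}"
    by (subst orbit_conv_funpow_dist1[OF assms], rule card_image, rule inj_on_funpow_dist1[OF assms])
  then show ?thesis by simp
qed

lemma funpow_card_orbit:
  assumes "x \<in> orbit f x"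
  shows "(f ^^ card (orbit f x)) x = x"
  using funpow_dist1_prop[OF assms] card_orbit[OF assms] by simp

lemma sum_orbit:
  fixes g :: "'a \<Rightarrow> 'b::comm_monoid_add"
  assumes "x \<in> orbit f x"
  shows "sum g (orbit f x) = (\<Sum>i<card (orbit f x). g ((f ^^ i) x))"
  by (subst orbit_conv_funpow_dist1[OF assms],
      subst sum.reindex[OF inj_on_funpow_dist1[OF assms]],
      simp add: card_orbit[OF assms] lessThan_atLeast0)

text \<open>
  An iterate that returns to \<open>x\<close> goes around the orbit a whole number of times.
\<close>

lemma funpow_sum_zero_if_orbit_sum_zero:
  fixes g :: "'a \<Rightarrow> real"
  assumes x: "x \<in> orbit f x" and zero: "sum g (orbit f x) = 0"
  shows "(f ^^ n) x = x \<Longrightarrow> (\<Sum>i<n. g ((f ^^ i) x)) = 0"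
proof (induction n rule: less_induct)
  case (less n)
  let ?N = "card (orbit f x)"
  show ?case
  proof (cases "n = 0")
    case False
    have N: "(f ^^ ?N) x = x" by (rule funpow_card_orbit[OF x])
    have "?N > 0" by (simp add: card_orbit[OF x])
    have le: "?N \<le> n"
      using funpow_dist1_le_self[OF less.prems _ x] False card_orbit[OF x] by simp
    have shift: "(f ^^ (i + ?N)) x = (f ^^ i) x" for i
      by (simp add: funpow_add N)
    have "(f ^^ (n - ?N)) x = x"
      using shift[of "n - ?N"] le less.prems by simp
    then have IH: "(\<Sum>i<n - ?N. g ((f ^^ i) x)) = 0"
      using less.IH[of "n - ?N"] \<open>?N > 0\<close> le by simp
    have "(\<Sum>i<n. g ((f ^^ i) x)) = (\<Sum>i<?N. g ((f ^^ i) x)) + (\<Sum>i=?N..<n. g ((f ^^ i) x))"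
      using le by (metis atLeast0LessThan sum.atLeastLessThan_concat zero_le)
    also have "(\<Sum>i=?N..<n. g ((f ^^ i) x)) = (\<Sum>i<n - ?N. g ((f ^^ (i + ?N)) x))"
      using sum.shift_bounds_nat_ivl[of "\<lambda>i. g ((f ^^ i) x)" 0 ?N "n - ?N"] le
      by (simp add: lessThan_atLeast0)
    finally show ?thesis
      using IH zero sum_orbit[OF x, of g] by (simp add: shift)
  qed simp
qed

lemma bij_betw_orbit:
  assumes "bij f" and "x \<in> orbit f x"
  shows "bij_betw f (orbit f x) (orbit f x)"
proof -
  have "f ` orbit f x = orbit f (f x)"
    by (rule orbit_inverse[OF assms(2)]) simp
  then show ?thesis
    using assms by (simp add: bij_betw_def self_in_orbit_step inj_on_subset[OF bij_is_inj])
qed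

lemma sum_mult_orbit_invariant:
  fixes g \<phi> :: "'a::finite \<Rightarrow> real"
  assumes "bij f" and inv: "\<And>x. \<phi> (f x) = \<phi> x" and zero: "\<And>x. sum g (orbit f x) = 0"
  shows "(\<Sum>x\<in>UNIV. \<phi> x * g x) = 0"
proof -
  have self: "x \<in> orbit f x" for x using mem_orbit_self[OF assms(1)] by simp
  have const: "y \<in> orbit f x \<Longrightarrow> \<phi> y = \<phi> x" for x y
    by (induction rule: orbit.induct) (simp_all add: inv)
  have "(\<Sum>x\<in>UNIV. \<phi> x * g x) = (\<Sum>x\<in>\<Union>(range (orbit f)). \<phi> x * g x)"
    using self by (intro sum.cong) auto
  also have "\<dots> = (\<Sum>B\<in>range (orbit f). \<Sum>x\<in>B. \<phi> x * g x)"
    using orbit_eq_if_mem[OF self] by (subst sum.Union_disjoint) (auto, metis+)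
  also have "\<dots> = 0"
  proof (rule sum.neutral, clarify)
    fix x
    have "(\<Sum>y\<in>orbit f x. \<phi> y * g y) = (\<Sum>y\<in>orbit f x. \<phi> x * g y)"
      by (rule sum.cong) (simp_all add: const)
    then show "(\<Sum>y\<in>orbit f x. \<phi> y * g y) = 0"
      by (simp add: zero flip: sum_distrib_left)
  qed
  finally show ?thesis .
qed

section \<open>Combinatorial maps\<close>

lemma
  assumes "combinatorial_map M"
  shows ccw_face_next: "ccw M (face_next M d) = opp M d"
    and face_next_opp_ccw: "face_next M (opp M (ccw M d)) = d"
    and bij_face_next: "bij (face_next M)"
    and opp_opp: "opp M (opp M d) = d"
    and bij_opp: "bij (opp M)"
    and bij_ccw: "bij (ccw M)"
proof -
  show bij: "bij (ccw M)" and oo: "opp M (opp M d) = d" for d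
    using assms by (auto simp: combinatorial_map_def)
  show bo: "bij (opp M)" by (rule o_bij[of "opp M"]) (auto simp: oo)
  have "face_next M = inv_into UNIV (ccw M) \<circ> opp M" by (auto simp: face_next_def)
  then show "bij (face_next M)" using bij bo by (simp add: bij_comp bij_imp_bij_inv)
  show "ccw M (face_next M d) = opp M d"
    unfolding face_next_def using bij by (simp add: bij_is_surj surj_f_inv_f)
  show "face_next M (opp M (ccw M d)) = d"
    unfolding face_next_def using bij by (simp add: oo bij_is_inj)
qed

lemma is_walk_append:
  "is_walk s t x (xs @ ys) y \<longleftrightarrow> (\<exists>z. is_walk s t x xs z \<and> is_walk s t z ys y)"
  by (induction xs arbitrary: x) auto

lemma sum_list_walk:
  fixes f :: "'x \<Rightarrow> real"
  assumes "is_walk s t x ds y"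
  shows "(\<Sum>d\<leftarrow>ds. f (t d) - f (s d)) = f y - f x"
  using assms by (induction ds arbitrary: x) force+

lemma walk_append: "walk M v (xs @ ys) w \<longleftrightarrow> (\<exists>u. walk M v xs u \<and> walk M u ys w)"
  by (simp add: walk_def is_walk_append)

lemma walk_simps [simp]:
  "walk M v [] w \<longleftrightarrow> v = w"
  "walk M v (d # ds) w \<longleftrightarrow> tail M d = v \<and> walk M (head M d) ds w"
  by (simp_all add: walk_def)

lemma walk_reverse:
  assumes "combinatorial_map M" and "walk M v ds w"
  shows "walk M w (rev (map (opp M) ds)) v"
  using assms(2)
  by (induction ds arbitrary: v) (auto simp: walk_append head_def opp_opp[OF assms(1)])

section \<open>Sections over a simply connected map\<close>

text \<open>
  A dart-level covering: over each dart of \<open>U\<close> lies a fibre of \<open>q\<close> in \<open>Z\<close>, and \<open>C\<close>, \<open>J\<close>, \<open>\<Phi>\<close> lift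
  \<open>ccw\<close>, \<open>opp\<close> and \<open>face_next\<close>.  The last two assumptions say that going once around a vertex or
  a face brings every point of the fibre back to itself, so that the covering is unramified.
\<close>

locale unramified_lift =
  fixes U :: "'e cmap" and q :: "'z \<Rightarrow> 'e" and Z :: "'z set" and C J \<Phi> :: "'z \<Rightarrow> 'z"
  assumes U: "combinatorial_map U"
    and tail_self: "\<And>e. e \<in> tail U e" and left_self: "\<And>e. e \<in> left U e"
    and C_Z: "\<And>z. z \<in> Z \<Longrightarrow> C z \<in> Z" and J_Z: "\<And>z. z \<in> Z \<Longrightarrow> J z \<in> Z"
    and \<Phi>_Z: "\<And>z. z \<in> Z \<Longrightarrow> \<Phi> z \<in> Z"
    and q_C: "\<And>z. z \<in> Z \<Longrightarrow> q (C z) = ccw U (q z)" and q_J: "\<And>z. z \<in> Z \<Longrightarrow> q (J z) = opp U (q z)"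
    and J_J: "\<And>z. z \<in> Z \<Longrightarrow> J (J z) = z" and C_\<Phi>: "\<And>z. z \<in> Z \<Longrightarrow> C (\<Phi> z) = J z"
    and C_return: "\<And>z n. z \<in> Z \<Longrightarrow> (ccw U ^^ n) (q z) = q z \<Longrightarrow> (C ^^ n) z = z"
    and \<Phi>_return: "\<And>z n. z \<in> Z \<Longrightarrow> (face_next U ^^ n) (q z) = q z \<Longrightarrow> (\<Phi> ^^ n) z = z"
begin

lemma q_\<Phi>: "z \<in> Z \<Longrightarrow> q (\<Phi> z) = face_next U (q z)"
  using q_C[OF \<Phi>_Z, of z] by (simp add: C_\<Phi> q_J face_next_def bij_is_inj[OF bij_ccw[OF U]])

lemma Cn_Z: "z \<in> Z \<Longrightarrow> (C ^^ n) z \<in> Z" and q_Cn: "z \<in> Z \<Longrightarrow> q ((C ^^ n) z) = (ccw U ^^ n) (q z)"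
  and \<Phi>n_Z: "z \<in> Z \<Longrightarrow> (\<Phi> ^^ n) z \<in> Z"
  and q_\<Phi>n: "z \<in> Z \<Longrightarrow> q ((\<Phi> ^^ n) z) = (face_next U ^^ n) (q z)"
  by (induction n) (simp_all add: C_Z q_C \<Phi>_Z q_\<Phi>)

lemma orbit_C_self: assumes "z \<in> Z" shows "z \<in> orbit C z"
proof -
  obtain n where "(ccw U ^^ n) (q z) = q z" "0 < n"
    using tail_self[of "q z"] unfolding tail_def orbit_altdef mem_Collect_eq by metis
  then show ?thesis
    using C_return[OF assms] unfolding orbit_altdef mem_Collect_eq by metis
qed

lemma orbit_C_Z: "y \<in> orbit C z \<Longrightarrow> z \<in> Z \<Longrightarrow> y \<in> Z"
  by (induction rule: orbit.induct) (simp_all add: C_Z)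

lemma orbit_C_eq: "y \<in> orbit C z \<Longrightarrow> z \<in> Z \<Longrightarrow> orbit C y = orbit C z"
  by (simp add: orbit_eq_if_mem orbit_C_self)

lemma tail_eq: "e \<in> tail U d \<Longrightarrow> tail U e = tail U d"
  unfolding tail_def by (rule orbit_eq_if_mem) (use tail_self in \<open>simp_all add: tail_def\<close>)

lemma orbit_C_tail: assumes "y \<in> orbit C z" "z \<in> Z" shows "tail U (q y) = tail U (q z)"
proof (rule tail_eq)
  show "q y \<in> tail U (q z)"
    using assms unfolding orbit_altdef tail_def by (auto simp: q_Cn)
qed

lemma orbit_C_unique:
  assumes "y \<in> orbit C z" "y' \<in> orbit C z" "z \<in> Z" "q y = q y'"
  shows "y = y'"
proof -
  have y: "y \<in> Z" "y' \<in> orbit C y"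
    using assms orbit_C_Z orbit_C_eq by blast+
  then obtain n where "y' = (C ^^ n) y" unfolding orbit_altdef by blast
  then show ?thesis using C_return[OF y(1), of n] q_Cn[OF y(1), of n] assms(4) by metis
qed

lemma orbit_C_ex:
  assumes "tail U d = tail U (q z)" "z \<in> Z" obtains y where "y \<in> orbit C z" "q y = d"
proof -
  have "d \<in> tail U (q z)" using tail_self[of d] assms by simp
  then obtain n where "d = (ccw U ^^ n) (q z)" "0 < n" unfolding tail_def orbit_altdef by blast
  then show ?thesis using that[of "(C ^^ n) z"] q_Cn[OF assms(2)] unfolding orbit_altdef by blast
qed

text \<open>
  Lifting a walk: turn around the current vertex until the point lies over the next dart, then
  cross that dart.  The end point is determined only up to turning.
\<close>

fun lifts :: "'z \<Rightarrow> 'e list \<Rightarrow> 'z \<Rightarrow> bool" where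
  "lifts z [] z' \<longleftrightarrow> z' \<in> orbit C z"
| "lifts z (d # ds) z' \<longleftrightarrow> (\<exists>y\<in>orbit C z. q y = d \<and> lifts (J y) ds z')"

lemma lifts_cong: "y \<in> orbit C z \<Longrightarrow> z \<in> Z \<Longrightarrow> lifts y ds = lifts z ds"
  by (cases ds) (auto simp: orbit_C_eq fun_eq_iff)

lemma lifts_Cons_at:
  assumes "y \<in> orbit C z" "z \<in> Z" "q y = d"
  shows "lifts z (d # ds) = lifts (J y) ds"
proof -
  have "x \<in> orbit C z \<and> q x = d \<longleftrightarrow> x = y" for x
    using assms orbit_C_unique by metis
  then have "lifts z (d # ds) w = lifts (J y) ds w" for w
    unfolding lifts.simps by metis
  then show ?thesis by blast
qed

lemma lifts_Z: "lifts z ds w \<Longrightarrow> z \<in> Z \<Longrightarrow> w \<in> Z"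
  by (induction ds arbitrary: z) (auto simp: orbit_C_Z J_Z)

lemma lifts_append:
  "z \<in> Z \<Longrightarrow> lifts z (xs @ ys) w \<longleftrightarrow> (\<exists>u. lifts z xs u \<and> lifts u ys w)"
proof (induction xs arbitrary: z)
  case Nil
  have "lifts u ys w \<longleftrightarrow> lifts z ys w" if "u \<in> orbit C z" for u
    using lifts_cong[OF that Nil] by simp
  then show ?case using orbit_C_self[OF Nil] by (metis append_Nil lifts.simps(1))
next
  case (Cons d ds)
  then show ?case by (auto simp: J_Z orbit_C_Z)
qed

lemma lifts_tail:
  "lifts z ds w \<Longrightarrow> z \<in> Z \<Longrightarrow> walk U (tail U (q z)) ds v \<Longrightarrow> tail U (q w) = v"
proof (induction ds arbitrary: z)
  case (Cons d ds)
  then obtain y where y: "y \<in> orbit C z" "q y = d" "lifts (J y) ds w" by auto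
  then show ?case
    using Cons.IH[of "J y"] Cons.prems by (simp add: J_Z orbit_C_Z q_J head_def)
qed (simp add: orbit_C_tail)

lemma lifts_ex: "z \<in> Z \<Longrightarrow> walk U (tail U (q z)) ds v \<Longrightarrow> \<exists>w. lifts z ds w"
proof (induction ds arbitrary: z)
  case Nil
  then show ?case using orbit_C_self by auto
next
  case (Cons d ds)
  then obtain y where y: "y \<in> orbit C z" "q y = d" using orbit_C_ex[of d z] by auto
  then show ?case
    using Cons.IH[of "J y"] Cons.prems y by (auto simp: J_Z orbit_C_Z q_J head_def)
qed

lemma lifts_reverse: "z \<in> Z \<Longrightarrow> lifts z ds w \<Longrightarrow> lifts w (rev (map (opp U) ds)) z"
proof (induction ds arbitrary: z)
  case Nil
  then show ?case using orbit_C_eq orbit_C_self by auto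
next
  case (Cons d ds)
  then obtain y where y: "y \<in> orbit C z" "q y = d" "lifts (J y) ds w" by auto
  have yZ: "y \<in> Z" using y orbit_C_Z Cons.prems by blast
  have "lifts w (rev (map (opp U) ds)) (J y)" using Cons.IH[OF J_Z[OF yZ] y(3)] .
  moreover have "lifts (J y) [opp U d] z"
    using lifts_Cons_at[OF orbit_C_self[OF J_Z[OF yZ]] J_Z[OF yZ], of "opp U d" "[]"] y(2)
      orbit_C_self[OF Cons.prems(1)] orbit_C_eq[OF y(1) Cons.prems(1)]
    by (simp add: q_J[OF yZ] J_J[OF yZ])
  moreover have "w \<in> Z" using lifts_Z[OF y(3)] J_Z[OF yZ] by simp
  ultimately show ?case by (auto simp: lifts_append)
qed

lemma lifts_backtrack:
  assumes "z \<in> Z" "tail U d = tail U (q z)"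
  shows "lifts z [d, opp U d] w \<longleftrightarrow> w \<in> orbit C z"
proof -
  obtain y where y: "y \<in> orbit C z" "q y = d" using orbit_C_ex assms by blast
  have yZ: "y \<in> Z" using y orbit_C_Z assms by blast
  have "lifts z [d, opp U d] w \<longleftrightarrow> lifts (J y) [opp U d] w"
    by (simp only: lifts_Cons_at[OF y(1) assms(1) y(2)])
  also have "\<dots> \<longleftrightarrow> w \<in> orbit C (J (J y))"
    using lifts_Cons_at[OF orbit_C_self[OF J_Z[OF yZ]] J_Z[OF yZ], of "opp U d" "[]"] y(2)
    by (simp add: q_J[OF yZ])
  finally show ?thesis using J_J[OF yZ] orbit_C_eq[OF y(1) assms(1)] by simp
qed

lemma lifts_face_steps:
  "y \<in> Z \<Longrightarrow> lifts y (map (\<lambda>i. (face_next U ^^ i) (q y)) [0..<n]) w \<longleftrightarrow> w \<in> orbit C ((\<Phi> ^^ n) y)"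
proof (induction n arbitrary: w)
  case (Suc n)
  let ?y = "(\<Phi> ^^ n) y"
  have yZ: "?y \<in> Z" using \<Phi>n_Z Suc.prems by blast
  have "lifts y (map (\<lambda>i. (face_next U ^^ i) (q y)) [0..<Suc n]) w \<longleftrightarrow>
      (\<exists>u\<in>orbit C ?y. lifts u [q ?y] w)"
    using Suc by (auto simp: lifts_append q_\<Phi>n simp del: lifts.simps)
  also have "\<dots> \<longleftrightarrow> lifts ?y [q ?y] w"
    using lifts_cong[OF _ yZ] orbit_C_self[OF yZ] by metis
  also have "\<dots> \<longleftrightarrow> w \<in> orbit C (J ?y)"
    using lifts_Cons_at[OF orbit_C_self[OF yZ] yZ HOL.refl, of "[]"] by simp
  also have "orbit C (J ?y) = orbit C (\<Phi> ?y)"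
    by (rule orbit_C_eq[OF _ \<Phi>_Z[OF yZ]]) (use C_\<Phi>[OF yZ] orbit.base[of C "\<Phi> ?y"] in simp)
  finally show ?case by simp
qed simp

lemma lifts_face:
  assumes "z \<in> Z" "tail U d = tail U (q z)"
  shows "lifts z (face_walk U d) w \<longleftrightarrow> w \<in> orbit C z"
proof -
  obtain y where y: "y \<in> orbit C z" "q y = d" using orbit_C_ex assms by blast
  have yZ: "y \<in> Z" using y orbit_C_Z assms by blast
  have "(face_next U ^^ card (left U d)) d = d"
    using funpow_card_orbit[of d "face_next U"] left_self[of d] by (simp add: left_def)
  then show ?thesis
    using lifts_face_steps[OF yZ, of "card (left U d)" w] \<Phi>_return[OF yZ, of "card (left U d)"] y
      lifts_cong[OF y(1) assms(1)] orbit_C_eq[OF y(1) assms(1)]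
    by (simp add: face_walk_def)
qed

text \<open>
  The common core of the two moves that generate homotopy: a closed piece \<open>ns\<close> that acts trivially
  on the points over its base vertex can be cut out of a walk.
\<close>

lemma lifts_remove_null:
  assumes null: "\<And>u x. u \<in> Z \<Longrightarrow> walk U (tail U (q u)) ns (tail U (q u)) \<Longrightarrow>
      lifts u ns x \<longleftrightarrow> x \<in> orbit C u"
    and loop: "\<And>u u'. walk U u ns u' \<Longrightarrow> u = u'"
    and walk: "walk U (tail U (q z)) (xs @ ns @ ys) w" and z: "z \<in> Z"
  shows "lifts z (xs @ ns @ ys) = lifts z (xs @ ys)"
proof (rule ext)
  fix x
  obtain v v' where v: "walk U (tail U (q z)) xs v" and v': "walk U v ns v'"
    using walk unfolding walk_append by blast
  have v_loop: "walk U v ns v" using v' loop[OF v'] by simp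
  \<comment> \<open>removing the piece changes the intermediate point only by turning around the vertex\<close>
  have step: "lifts a (ns @ ys) x \<longleftrightarrow> lifts a ys x" if a: "lifts z xs a" for a
  proof -
    have aZ: "a \<in> Z" and av: "tail U (q a) = v" using lifts_Z[OF a z] lifts_tail[OF a z v] by simp_all
    have "lifts a (ns @ ys) x \<longleftrightarrow> (\<exists>b\<in>orbit C a. lifts b ys x)"
      unfolding lifts_append[OF aZ] using null[of a] aZ av v_loop by (simp add: Bex_def)
    also have "\<dots> \<longleftrightarrow> lifts a ys x"
      using lifts_cong[OF _ aZ] orbit_C_self[OF aZ] by metis
    finally show ?thesis .
  qed
  show "lifts z (xs @ ns @ ys) x = lifts z (xs @ ys) x"
    unfolding lifts_append[OF z] using step by metis
qed

lemma lifts_homotopic: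
  "walk_homotopic U v w xs ys \<Longrightarrow> z \<in> Z \<Longrightarrow> tail U (q z) = v \<Longrightarrow> lifts z xs = lifts z ys"
proof (induction rule: walk_homotopic.induct)
  case (backtrack xs d ys)
  show ?case
    by (rule lifts_remove_null)
       (use backtrack in \<open>auto simp: head_def opp_opp[OF U] simp del: lifts.simps intro!: lifts_backtrack\<close>)
next
  case (face xs d ys)
  let ?n = "card (left U d)"
  have pos: "?n > 0"
    using left_self[of d] card_orbit[of d "face_next U"] by (simp add: left_def)
  have hd: "face_walk U d = d # map (\<lambda>i. (face_next U ^^ i) d) [1..<?n]"
    unfolding face_walk_def using pos by (simp add: upt_conv_Cons)
  have ends: "walk U (tail U d) (map (\<lambda>i. (face_next U ^^ i) d) [0..<m]) (tail U ((face_next U ^^ m) d))" for m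
  proof (induction m)
    case (Suc m)
    let ?e = "(face_next U ^^ m) d"
    have "head U ?e = tail U (face_next U ?e)"
      unfolding head_def using tail_eq[of "opp U ?e" "face_next U ?e"]
        orbit.base[of "ccw U" "face_next U ?e"] by (simp add: tail_def ccw_face_next[OF U])
    with Suc show ?case by (auto simp: walk_append)
  qed simp
  have closed: "(face_next U ^^ ?n) d = d"
    using funpow_card_orbit[of d "face_next U"] left_self[of d] by (simp add: left_def)
  have loop: "walk U u (face_walk U d) u' \<Longrightarrow> u = u'" for u u'
  proof -
    assume "walk U u (face_walk U d) u'"
    moreover have "walk U (tail U d) (face_walk U d) (tail U d)"
      using ends[of ?n] closed by (simp add: face_walk_def)
    moreover have "is_walk s t x ds y \<Longrightarrow> is_walk s t x ds y' \<Longrightarrow> y = y'" for s t x y y' and ds :: "'e list"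
      by (induction ds arbitrary: x) auto
    ultimately show "u = u'" using hd unfolding walk_def by (metis is_walk.simps(2))
  qed
  show ?case
  proof (rule lifts_remove_null[OF _ loop])
    fix u x assume u: "u \<in> Z" "walk U (tail U (q u)) (face_walk U d) (tail U (q u))"
    then show "lifts u (face_walk U d) x \<longleftrightarrow> x \<in> orbit C u"
      by (intro lifts_face) (simp_all add: hd)
  qed (use face in auto)
qed auto

text \<open>
  Two lifts over the same dart are joined by the lift of a closed walk; this walk is contractible,
  so the lift closes up.  Hence transporting \<open>z\<^sub>0\<close> along walks is well defined.
\<close>

theorem section_exists:
  assumes sc: "cmap_simply_connected U" and z0: "z\<^sub>0 \<in> Z"
  obtains s where "\<And>e. s e \<in> Z" "\<And>e. q (s e) = e" "\<And>e. s (ccw U e) = C (s e)"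
    "\<And>e. s (opp U e) = J (s e)" "s (q z\<^sub>0) = z\<^sub>0"
proof -
  let ?v = "tail U (q z\<^sub>0)"
  define R where "R e z \<longleftrightarrow> q z = e \<and> (\<exists>ds. walk U ?v ds (tail U e) \<and> lifts z\<^sub>0 ds z)" for e z
  have RZ: "R e z \<Longrightarrow> z \<in> Z" for e z using lifts_Z z0 by (auto simp: R_def)
  have unique: "z = z'" if R: "R e z" "R e z'" for e z z'
  proof -
    obtain ds ds' where ds: "walk U ?v ds (tail U e)" "lifts z\<^sub>0 ds z"
        "walk U ?v ds' (tail U e)" "lifts z\<^sub>0 ds' z'" and q: "q z = e" "q z' = e"
      using R by (auto simp: R_def)
    let ?l = "rev (map (opp U) ds) @ ds'"
    have "walk U (tail U e) ?l (tail U e)"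
      using walk_reverse[OF U ds(1)] ds(3) by (auto simp: walk_append)
    then have "walk_homotopic U (tail U e) (tail U e) ?l []"
      using sc by (auto simp: cmap_simply_connected_def vertices_def)
    moreover have "lifts z ?l z'"
      using lifts_reverse[OF z0 ds(2)] ds(4) RZ[OF R(1)] by (auto simp: lifts_append)
    ultimately have "z' \<in> orbit C z"
      using lifts_homotopic RZ[OF R(1)] q by fastforce
    then show ?thesis using orbit_C_unique orbit_C_self RZ[OF R(1)] q by metis
  qed
  have ex: "\<exists>z. R e z" for e
  proof -
    obtain ds where ds: "walk U ?v ds (tail U e)"
      using sc by (force simp: cmap_simply_connected_def cmap_connected_def vertices_def)
    then obtain w where w: "lifts z\<^sub>0 ds w" using lifts_ex z0 by blast
    have wZ: "w \<in> Z" "tail U e = tail U (q w)" using lifts_Z lifts_tail z0 w ds by metis+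
    then obtain y where y: "y \<in> orbit C w" "q y = e" using orbit_C_ex by blast
    have "lifts z\<^sub>0 (ds @ []) y" unfolding lifts_append[OF z0] using w y by auto
    then show ?thesis using ds y by (auto simp: R_def)
  qed
  define s where "s e = (THE z. R e z)" for e
  have sR: "R e (s e)" for e
    unfolding s_def using ex unique by (metis theI)
  have s_eq: "R e z \<Longrightarrow> s e = z" for e z using sR unique by blast
  show ?thesis
  proof (rule that[of s])
    fix e
    show sZ: "s e \<in> Z" using RZ sR by blast
    show q: "q (s e) = e" using sR by (simp add: R_def)
    obtain ds where ds: "walk U ?v ds (tail U e)" "lifts z\<^sub>0 ds (s e)"
      using sR by (auto simp: R_def)
    have "lifts z\<^sub>0 (ds @ []) (C (s e))"
      unfolding lifts_append[OF z0] using ds orbit.base[of C] by auto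
    moreover have "tail U (ccw U e) = tail U e"
      by (rule tail_eq) (simp add: tail_def orbit.base)
    ultimately show "s (ccw U e) = C (s e)"
      using ds by (intro s_eq) (auto simp: R_def q_C sZ q)
    have "lifts z\<^sub>0 (ds @ [e]) (J (s e))"
      unfolding lifts_append[OF z0] using ds orbit_C_self sZ q J_Z by force
    moreover have "walk U ?v (ds @ [e]) (tail U (opp U e))"
      using ds by (auto simp: walk_append head_def)
    ultimately show "s (opp U e) = J (s e)"
      by (intro s_eq) (auto simp: R_def q_J sZ q)
  next
    have "lifts z\<^sub>0 [] z\<^sub>0" using orbit_C_self z0 by simp
    then show "s (q z\<^sub>0) = z\<^sub>0" by (intro s_eq) (use z0 in \<open>auto simp: R_def intro!: exI[of _ "[]"]\<close>)
  qed
qed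

end

section \<open>The universal cover of a torus map\<close>

locale torus_cover =
  fixes G :: "('d::finite) cmap" and U :: "'e cmap" and p :: "'e \<Rightarrow> 'd" and \<gamma>1 \<gamma>2 :: "'e \<Rightarrow> 'e"
  assumes G: "combinatorial_map G"
    and cover: "universal_cover G U p"
    and gens: "positive_generators G U p \<gamma>1 \<gamma>2"
begin

lemma U: "combinatorial_map U" and sc: "cmap_simply_connected U"
  and p_ccw: "p (ccw U e) = ccw G (p e)" and p_opp: "p (opp U e) = opp G (p e)"
  and inj_tail: "inj_on p (tail U e)" and inj_left: "inj_on p (left U e)"
  and surj_p: "surj p"
  using cover by (auto simp: universal_cover_def covering_map_def vertices_def faces_def)

lemma p_face_next: "p (face_next U e) = face_next G (p e)"
proof -
  have "ccw G (p (face_next U e)) = ccw G (face_next G (p e))"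
    by (simp add: ccw_face_next[OF U] ccw_face_next[OF G] p_opp flip: p_ccw)
  then show ?thesis using bij_is_inj[OF bij_ccw[OF G]] by (simp add: inj_eq)
qed

lemma finite_tail: "finite (tail U e)" and finite_left: "finite (left U e)"
  by (rule finite_imageD[OF _ inj_tail], simp) (rule finite_imageD[OF _ inj_left], simp)

lemma tail_self: "e \<in> tail U e" and left_self: "e \<in> left U e"
  using mem_orbit_self[OF bij_ccw[OF U]] mem_orbit_self[OF bij_face_next[OF U]]
    finite_tail[of e] finite_left[of e] by (auto simp: tail_def left_def)

lemma p_funpow:
  "p ((ccw U ^^ n) e) = (ccw G ^^ n) (p e)" "p ((face_next U ^^ n) e) = (face_next G ^^ n) (p e)"
  by (induction n) (simp_all add: p_ccw p_face_next)

lemma ccw_return: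
  assumes "(ccw G ^^ n) (p e) = p e" shows "(ccw U ^^ n) e = e"
proof (rule inj_onD[OF inj_tail[of e]])
  show "(ccw U ^^ n) e \<in> tail U e" using tail_self unfolding tail_def by (rule funpow_in_orbit)
qed (simp_all add: p_funpow assms tail_self)

lemma face_next_return:
  assumes "(face_next G ^^ n) (p e) = p e" shows "(face_next U ^^ n) e = e"
proof (rule inj_onD[OF inj_left[of e]])
  show "(face_next U ^^ n) e \<in> left U e" using left_self unfolding left_def by (rule funpow_in_orbit)
qed (simp_all add: p_funpow assms left_self)

lemma image_tail: "p ` tail U e = tail G (p e)" and image_left: "p ` left U e = left G (p e)"
  using orbit_inverse[of e "ccw U" "ccw G" p] orbit_inverse[of e "face_next U" "face_next G" p]
    tail_self[of e] left_self[of e]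
  by (simp_all add: tail_def left_def p_ccw p_face_next)

lemma sum_tail: "(\<Sum>d\<in>tail G (p e). g d) = (\<Sum>x\<in>tail U e. g (p x))"
  and sum_left: "(\<Sum>d\<in>left G (p e). g d) = (\<Sum>x\<in>left U e. g (p x))"
  using sum.reindex[OF inj_tail, of g e] sum.reindex[OF inj_left, of g e]
  by (simp_all add: image_tail image_left comp_def)

text \<open>
  A connected map has a single orbit of darts under the two permutations.
\<close>

lemma dart_induct:
  assumes e: "P e" and ccw: "\<And>x. P x \<Longrightarrow> P (ccw U x)" and opp: "\<And>x. P x \<Longrightarrow> P (opp U x)"
  shows "P y"
proof -
  have turn: "P y" if "P x" "tail U x = tail U y" for x y
  proof -
    have "y \<in> orbit (ccw U) x" using that(2) tail_self[of y] by (simp add: tail_def)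
    then show ?thesis by (induction rule: orbit.induct) (use that ccw in auto)
  qed
  have "P y" if "walk U (tail U x) ds (tail U y)" "P x" for x ds
    using that
  proof (induction ds arbitrary: x)
    case Nil
    then show ?case using turn by simp
  next
    case (Cons d ds)
    then have "P d" using turn[of x d] by simp
    then show ?case using Cons.IH[of "opp U d"] Cons.prems opp by (simp add: head_def)
  qed
  moreover obtain ds where "walk U (tail U e) ds (tail U y)"
    using sc by (force simp: cmap_simply_connected_def cmap_connected_def vertices_def)
  ultimately show ?thesis using e by blast
qed

lemma dart_invariant_const:
  assumes "\<And>x. f (ccw U x) = f x" "\<And>x. f (opp U x) = f x"
  shows "f x = f y"
  by (rule dart_induct[of "\<lambda>x. f x = f y" y]) (simp_all add: assms)

text \<open>
  The fibre product of \<open>p\<close> with itself is unramified over \<open>U\<close>, hence has a section through any given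
  point \<open>(e, e')\<close>; its second component is the required map.
\<close>

lemma ex_equivariant:
  assumes "p e = p e'"
  obtains g where "g e = e'" "\<And>x. p (g x) = p x"
    "\<And>x. g (ccw U x) = ccw U (g x)" "\<And>x. g (opp U x) = opp U (g x)"
proof -
  have pow: "(map_prod f f ^^ n) z = map_prod (f ^^ n) (f ^^ n) z" for f :: "'e \<Rightarrow> 'e" and n z
    by (induction n arbitrary: z) (auto simp: funpow_swap1)
  interpret unramified_lift U fst "{(x, y). p x = p y}" "map_prod (ccw U) (ccw U)"
      "map_prod (opp U) (opp U)" "map_prod (face_next U) (face_next U)"
  proof unfold_locales
    fix z n assume z: "z \<in> {(x, y). p x = p y}"
    { assume "(ccw U ^^ n) (fst z) = fst z"
      moreover from this have "(ccw U ^^ n) (snd z) = snd z"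
        using z p_funpow(1)[of n "fst z"] by (intro ccw_return) auto
      ultimately show "(map_prod (ccw U) (ccw U) ^^ n) z = z"
        unfolding pow by (cases z) auto }
    { assume "(face_next U ^^ n) (fst z) = fst z"
      moreover from this have "(face_next U ^^ n) (snd z) = snd z"
        using z p_funpow(2)[of n "fst z"] by (intro face_next_return) auto
      ultimately show "(map_prod (face_next U) (face_next U) ^^ n) z = z"
        unfolding pow by (cases z) auto }
  qed (auto simp: U tail_self left_self p_ccw p_opp p_face_next opp_opp[OF U] ccw_face_next[OF U])
  obtain s where s: "\<And>e. s e \<in> {(x, y). p x = p y}" "\<And>e. fst (s e) = e"
      "\<And>e. s (ccw U e) = map_prod (ccw U) (ccw U) (s e)"
      "\<And>e. s (opp U e) = map_prod (opp U) (opp U) (s e)" "s (fst (e, e')) = (e, e')"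
    using section_exists[OF sc, of "(e, e')"] assms by auto
  show ?thesis
  proof (rule that[of "snd \<circ> s"])
    show "p ((snd \<circ> s) x) = p x" for x
      using s(1)[of x] s(2)[of x] by (auto split: prod.splits)
  qed (use s in auto)
qed

lemma equivariant_unique:
  assumes "\<And>x. g (ccw U x) = ccw U (g x)" "\<And>x. g (opp U x) = opp U (g x)"
    "\<And>x. g' (ccw U x) = ccw U (g' x)" "\<And>x. g' (opp U x) = opp U (g' x)" "g e = g' e"
  shows "g = g'"
proof
  show "g x = g' x" for x
    by (rule dart_induct[of "\<lambda>x. g x = g' x" e]) (simp_all add: assms)
qed

lemma deck_transitive:
  assumes "p e = p e'"
  obtains g where "deck_transformation U p g" "g e = e'"
proof -
  obtain g where g: "g e = e'" "\<And>x. p (g x) = p x"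
      "\<And>x. g (ccw U x) = ccw U (g x)" "\<And>x. g (opp U x) = opp U (g x)"
    using ex_equivariant[OF assms] by metis
  obtain g' where g': "g' e' = e" "\<And>x. p (g' x) = p x"
      "\<And>x. g' (ccw U x) = ccw U (g' x)" "\<And>x. g' (opp U x) = opp U (g' x)"
    using ex_equivariant[of e' e] assms by metis
  have "g' \<circ> g = id" by (rule equivariant_unique[of _ _ e]) (simp_all add: g g')
  moreover have "g \<circ> g' = id" by (rule equivariant_unique[of _ _ e']) (simp_all add: g g')
  ultimately have "bij g" by (rule o_bij)
  then show ?thesis using that[of g] g by (simp add: deck_transformation_def)
qed

lemma deck_group: "group (deck_group U p)"
proof (rule groupI)
  fix g assume "g \<in> carrier (deck_group U p)"
  then have g: "bij g" "\<And>e. p (g e) = p e" "\<And>e. g (ccw U e) = ccw U (g e)" "\<And>e. g (opp U e) = opp U (g e)"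
    by (auto simp: deck_group_def deck_transformation_def)
  let ?h = "inv_into UNIV g"
  have h: "g (?h e) = e" "?h (g e) = e" for e
    using g(1) by (simp_all add: bij_is_surj surj_f_inv_f bij_is_inj)
  have "p (?h e) = p e" "?h (ccw U e) = ccw U (?h e)" "?h (opp U e) = opp U (?h e)" for e
    using g(2-4)[of "?h e"] h by metis+
  then have "deck_transformation U p ?h"
    using g(1) bij_imp_bij_inv by (auto simp: deck_transformation_def)
  moreover have "?h \<circ> g = id" using h by auto
  ultimately show "\<exists>y\<in>carrier (deck_group U p). y \<otimes>\<^bsub>deck_group U p\<^esub> g = \<one>\<^bsub>deck_group U p\<^esub>"
    by (auto simp: deck_group_def)
qed (auto simp: deck_group_def deck_transformation_def bij_comp)

lemma gen_deck: "deck_transformation U p \<gamma>1" "deck_transformation U p \<gamma>2"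
  using gens by (simp_all add: positive_generators_def)

definition shifts :: "('e \<Rightarrow> real) \<Rightarrow> real \<Rightarrow> real \<Rightarrow> bool" where
  "shifts f a b \<longleftrightarrow> (\<forall>e. f (\<gamma>1 e) = f e + a \<and> f (\<gamma>2 e) = f e + b)"

text \<open>
  Invariance under two maps passes to their inverses and compositions.
\<close>

lemma invariant_deck:
  assumes f: "shifts f 0 0" and g: "deck_transformation U p g"
  shows "f (g e) = f e"
proof -
  interpret group "deck_group U p" by (rule deck_group)
  have \<gamma>: "\<gamma> \<in> carrier (deck_group U p)" "f (\<gamma> x) = f x" if "\<gamma> \<in> {\<gamma>1, \<gamma>2}" for \<gamma> x
    using that gen_deck f by (auto simp: deck_group_def shifts_def)
  have "g \<in> generate (deck_group U p) {\<gamma>1, \<gamma>2}"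
    using gens g by (simp add: positive_generators_def deck_group_def)
  then have "\<forall>x. f (g x) = f x"
  proof (induction rule: generate.induct)
    case (inv \<gamma>)
    have "\<gamma> \<circ> m_inv (deck_group U p) \<gamma> = id"
      using r_inv[OF \<gamma>(1)[OF inv]] by (simp add: deck_group_def)
    then show ?case using \<gamma>(2)[OF inv] by (metis comp_apply id_apply)
  qed (use \<gamma>(2) in \<open>auto simp: deck_group_def\<close>)
  then show ?thesis by blast
qed

lemma invariant_fibre:
  assumes "shifts f 0 0" and "p x = p y"
  shows "f x = f y"
  using deck_transitive[OF assms(2)] invariant_deck[OF assms(1)] by metis

text \<open>
  The sum over the darts of \<open>G\<close> of a function on the darts of \<open>U\<close>; it deserves this name when the
  function is invariant under the deck group.
\<close>

definition dsum :: "('e \<Rightarrow> real) \<Rightarrow> real" where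
  "dsum f = (\<Sum>d\<in>UNIV. f (inv_into UNIV p d))"

lemma p_lift [simp]: "p (inv_into UNIV p d) = d"
  using surj_p by (rule surj_f_inv_f)

lemma lift_invariant: "shifts f 0 0 \<Longrightarrow> f (inv_into UNIV p (p e)) = f e"
  by (rule invariant_fibre) simp_all

lemma dsum_p: "dsum (\<lambda>e. f (p e)) = (\<Sum>d\<in>UNIV. f d)"
  by (simp add: dsum_def)

lemma dsum_add: "dsum (\<lambda>e. f e + g e) = dsum f + dsum g"
  and dsum_diff: "dsum (\<lambda>e. f e - g e) = dsum f - dsum g"
  and dsum_minus: "dsum (\<lambda>e. - f e) = - dsum f"
  and dsum_scale: "dsum (\<lambda>e. r * f e) = r * dsum f"
  and dsum_linear: "dsum (\<lambda>e. r * f e + s * g e) = r * dsum f + s * dsum g"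
  by (simp_all add: dsum_def sum.distrib sum_subtractf sum_negf sum_distrib_left)

lemma dsum_reindex:
  assumes f: "shifts f 0 0" and p: "\<And>e. p (\<sigma> e) = \<rho> (p e)" and "bij \<rho>"
  shows "dsum (\<lambda>e. f (\<sigma> e)) = dsum f"
proof -
  have "f (\<sigma> (inv_into UNIV p d)) = f (inv_into UNIV p (\<rho> d))" for d
    by (rule invariant_fibre[OF f]) (simp add: p)
  then show ?thesis
    unfolding dsum_def using sum.reindex_bij_betw[OF assms(3), of "\<lambda>d. f (inv_into UNIV p d)"] by simp
qed

lemma dsum_opp: "shifts f 0 0 \<Longrightarrow> dsum (\<lambda>e. f (opp U e)) = dsum f"
  and dsum_face_next: "shifts f 0 0 \<Longrightarrow> dsum (\<lambda>e. f (face_next U e)) = dsum f"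
  using dsum_reindex p_opp bij_opp[OF G] dsum_reindex p_face_next bij_face_next[OF G] by blast+

text \<open>
  Grouping the darts by vertices (faces), \<open>\<phi>\<close> comes out of each partial sum.  With \<open>g\<close> a coclosed
  (closed) form, this is the orthogonality of exact and coclosed forms on \<open>G\<close> (on its dual).
\<close>

lemma dsum_mult_vertex_sum_zero:
  assumes "shifts \<phi> 0 0" "shifts g 0 0" and inv: "\<And>e. \<phi> (ccw U e) = \<phi> e"
    and zero: "\<And>e. (\<Sum>x\<in>tail U e. g x) = 0"
  shows "dsum (\<lambda>e. \<phi> e * g e) = 0"
  unfolding dsum_def
proof (rule sum_mult_orbit_invariant[OF bij_ccw[OF G]])
  let ?l = "inv_into UNIV p"
  show "\<phi> (?l (ccw G d)) = \<phi> (?l d)" for d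
    using invariant_fibre[OF assms(1), of "?l (ccw G d)" "ccw U (?l d)"] by (simp add: p_ccw inv)
  show "(\<Sum>d\<in>orbit (ccw G) d. g (?l d)) = 0" for d
    using sum_tail[of "\<lambda>d. g (?l d)" "?l d"] zero[of "?l d"]
    by (simp add: tail_def lift_invariant[OF assms(2)])
qed

lemma dsum_mult_face_sum_zero:
  assumes "shifts \<phi> 0 0" "shifts g 0 0" and inv: "\<And>e. \<phi> (face_next U e) = \<phi> e"
    and zero: "\<And>e. (\<Sum>x\<in>left U e. g x) = 0"
  shows "dsum (\<lambda>e. \<phi> e * g e) = 0"
  unfolding dsum_def
proof (rule sum_mult_orbit_invariant[OF bij_face_next[OF G]])
  let ?l = "inv_into UNIV p"
  show "\<phi> (?l (face_next G d)) = \<phi> (?l d)" for d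
    using invariant_fibre[OF assms(1), of "?l (face_next G d)" "face_next U (?l d)"]
    by (simp add: p_face_next inv)
  show "(\<Sum>d\<in>orbit (face_next G) d. g (?l d)) = 0" for d
    using sum_left[of "\<lambda>d. g (?l d)" "?l d"] zero[of "?l d"]
    by (simp add: left_def lift_invariant[OF assms(2)])
qed

lemma gen_commute:
  "\<gamma>1 (ccw U e) = ccw U (\<gamma>1 e)" "\<gamma>2 (ccw U e) = ccw U (\<gamma>2 e)"
  "\<gamma>1 (opp U e) = opp U (\<gamma>1 e)" "\<gamma>2 (opp U e) = opp U (\<gamma>2 e)"
  "p (\<gamma>1 e) = p e" "p (\<gamma>2 e) = p e"
  using gen_deck by (simp_all add: deck_transformation_def)

lemma deck_face_next:
  assumes "deck_transformation U p g" shows "g (face_next U e) = face_next U (g e)"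
proof -
  have "ccw U (g (face_next U e)) = ccw U (face_next U (g e))"
    using assms by (metis deck_transformation_def ccw_face_next[OF U])
  then show ?thesis using bij_is_inj[OF bij_ccw[OF U]] by (simp add: inj_eq)
qed

lemma deck_tail: "deck_transformation U p g \<Longrightarrow> g ` tail U e = tail U (g e)"
  and deck_left: "deck_transformation U p g \<Longrightarrow> g ` left U e = left U (g e)"
  using orbit_inverse[of e "ccw U" "ccw U" g] orbit_inverse[of e "face_next U" "face_next U" g]
    tail_self[of e] left_self[of e] deck_face_next[of g]
  by (auto simp: tail_def left_def deck_transformation_def)

text \<open>
  Functions on the vertices or faces of \<open>U\<close> are represented by functions on darts that are
  constant around each vertex or face, so that both can be combined; \<open>a\<close> and \<open>b\<close> are the periods.
\<close>

definition vertex_fun :: "('e \<Rightarrow> real) \<Rightarrow> real \<Rightarrow> real \<Rightarrow> bool" where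
  "vertex_fun W a b \<longleftrightarrow> (\<forall>e. W (ccw U e) = W e) \<and> shifts W a b"

definition face_fun :: "('e \<Rightarrow> real) \<Rightarrow> real \<Rightarrow> real \<Rightarrow> bool" where
  "face_fun N a b \<longleftrightarrow> (\<forall>e. N (face_next U e) = N e) \<and> shifts N a b"

definition diff :: "('e \<Rightarrow> real) \<Rightarrow> 'e \<Rightarrow> real" where
  "diff W e = W (opp U e) - W e"

lemma shifts_diff: "shifts W a b \<Longrightarrow> shifts (diff W) 0 0"
  by (simp add: shifts_def diff_def flip: gen_commute)

lemma diff_opp: "diff W (opp U e) = - diff W e"
  by (simp add: diff_def opp_opp[OF U])

lemma diff_linear:
  "diff (\<lambda>e. r * W e + s * W' e) e = r * diff W e + s * diff W' e"
  by (simp add: diff_def algebra_simps)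

lemma shifts_linear:
  assumes "shifts W a b" "shifts W' a' b'"
  shows "shifts (\<lambda>e. r * W e + s * W' e) (r * a + s * a') (r * b + s * b')"
  using assms by (simp add: shifts_def algebra_simps)

lemma shifts_mult: "shifts f 0 0 \<Longrightarrow> shifts g 0 0 \<Longrightarrow> shifts (\<lambda>e. f e * g e) 0 0"
  by (simp add: shifts_def)

lemma vertex_fun_diff: "vertex_fun W a b \<Longrightarrow> shifts (diff W) 0 0"
  and face_fun_diff: "face_fun N a b \<Longrightarrow> shifts (diff N) 0 0"
  unfolding vertex_fun_def face_fun_def using shifts_diff by blast+

lemma vertex_fun_linear:
  "vertex_fun W a b \<Longrightarrow> vertex_fun W' a' b' \<Longrightarrow>
    vertex_fun (\<lambda>e. r * W e + s * W' e) (r * a + s * a') (r * b + s * b')"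
  using shifts_linear by (simp add: vertex_fun_def)

lemma face_fun_linear:
  "face_fun W a b \<Longrightarrow> face_fun W' a' b' \<Longrightarrow>
    face_fun (\<lambda>e. r * W e + s * W' e) (r * a + s * a') (r * b + s * b')"
  using shifts_linear by (simp add: face_fun_def)

lemma vertex_fun_face_next: "vertex_fun W a b \<Longrightarrow> W (face_next U e) = W (opp U e)"
  by (metis vertex_fun_def ccw_face_next[OF U])

lemma diff_vertex_fun_face_sum:
  assumes "vertex_fun W a b" shows "(\<Sum>x\<in>left U e. diff W x) = 0"
proof -
  have "(\<Sum>x\<in>left U e. W (face_next U x)) = (\<Sum>x\<in>left U e. W x)"
    unfolding left_def using left_self[unfolded left_def]
    by (intro sum.reindex_bij_betw bij_betw_orbit bij_face_next[OF U])
  then show ?thesis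
    by (simp add: diff_def sum_subtractf vertex_fun_face_next[OF assms])
qed

section \<open>Potentials of closed and coclosed forms\<close>

text \<open>
  Sections of a flat line bundle: over each dart of \<open>U\<close> put a copy of the reals, and let the two
  permutations of the darts act with increments \<open>a\<close> and \<open>b\<close>.  The vanishing sums around vertices
  and faces say that this covering is unramified.
\<close>

lemma ex_potential:
  fixes a b :: "'e \<Rightarrow> real"
  assumes b: "\<And>e. b (opp U e) = - b e" and vertex: "\<And>e. (\<Sum>x\<in>tail U e. a x) = 0"
    and face: "\<And>e. (\<Sum>x\<in>left U e. b x - a (face_next U x)) = 0"
  obtains X where "\<And>e. X (ccw U e) = X e + a e" "\<And>e. X (opp U e) = X e + b e"
proof -
  define \<phi> where "\<phi> e = b e - a (face_next U e)" for e
  have pow: "((\<lambda>(e, x). (f e, x + g e)) ^^ n) z = ((f ^^ n) (fst z), snd z + (\<Sum>i<n. g ((f ^^ i) (fst z))))"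
    for f :: "'e \<Rightarrow> 'e" and g :: "'e \<Rightarrow> real" and n z
    by (induction n) auto
  interpret unramified_lift U fst UNIV "\<lambda>(e, x). (ccw U e, x + a e)"
      "\<lambda>(e, x). (opp U e, x + b e)" "\<lambda>(e, x). (face_next U e, x + \<phi> e)"
  proof unfold_locales
    fix z :: "'e \<times> real" and n
    { assume "(ccw U ^^ n) (fst z) = fst z"
      moreover from this have "(\<Sum>i<n. a ((ccw U ^^ i) (fst z))) = 0"
        using tail_self vertex by (intro funpow_sum_zero_if_orbit_sum_zero) (auto simp: tail_def)
      ultimately show "((\<lambda>(e, x). (ccw U e, x + a e)) ^^ n) z = z"
        unfolding pow by (cases z) auto }
    { assume "(face_next U ^^ n) (fst z) = fst z"
      moreover from this have "(\<Sum>i<n. \<phi> ((face_next U ^^ i) (fst z))) = 0"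
        using left_self face by (intro funpow_sum_zero_if_orbit_sum_zero) (auto simp: left_def \<phi>_def)
      ultimately show "((\<lambda>(e, x). (face_next U e, x + \<phi> e)) ^^ n) z = z"
        unfolding pow by (cases z) auto }
  qed (auto simp: U tail_self left_self b \<phi>_def opp_opp[OF U] ccw_face_next[OF U])
  obtain s where s: "\<And>e. fst (s e) = e" "\<And>e. s (ccw U e) = (\<lambda>(e, x). (ccw U e, x + a e)) (s e)"
      "\<And>e. s (opp U e) = (\<lambda>(e, x). (opp U e, x + b e)) (s e)"
    by (rule section_exists[OF sc UNIV_I[of "(undefined, 0)"]]) blast
  show ?thesis
  proof (rule that[of "snd \<circ> s"])
    fix e
    show "(snd \<circ> s) (ccw U e) = (snd \<circ> s) e + a e" "(snd \<circ> s) (opp U e) = (snd \<circ> s) e + b e"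
      using s(1)[of e] by (cases "s e"; simp add: s)+
  qed
qed

lemma potential_shifts:
  assumes X: "\<And>e. X (ccw U e) = X e + a (p e)" "\<And>e. X (opp U e) = X e + b (p e)"
  obtains s t where "shifts X s t"
proof -
  \<comment> \<open>the increments descend to \<open>G\<close>, so \<open>X \<circ> \<gamma>\<close> and \<open>X\<close> have the same increments\<close>
  have "X (\<gamma>1 x) - X x = X (\<gamma>1 y) - X y" "X (\<gamma>2 x) - X x = X (\<gamma>2 y) - X y" for x y
    by (rule dart_invariant_const; simp add: X gen_commute)+
  then have "shifts X (X (\<gamma>1 undefined) - X undefined) (X (\<gamma>2 undefined) - X undefined)"
    unfolding shifts_def by (metis add.commute diff_add_cancel)
  then show ?thesis by (rule that)
qed

text \<open>
  Functions on vertices and functions on faces are both functions on darts, so the same potential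
  lemma integrates closed forms (no increment around a vertex) and coclosed forms (no increment
  around a face).  In this way simple connectivity of \<open>U\<close> serves for its dual complex as well.
\<close>

lemma closed_form_potential:
  assumes \<theta>: "closed_1form G \<theta>"
  obtains W a b where "vertex_fun W a b" "\<And>e. diff W e = \<theta> (p e)"
proof -
  have "(\<Sum>x\<in>left U e. \<theta> (p x)) = 0" for e
    using \<theta> sum_left[of \<theta> e] by (auto simp: closed_1form_def faces_def)
  then obtain W where W: "\<And>e. W (ccw U e) = W e" "\<And>e. W (opp U e) = W e + \<theta> (p e)"
    using ex_potential[of "\<lambda>e. \<theta> (p e)" "\<lambda>_. 0"] \<theta> by (auto simp: closed_1form_def p_opp)
  moreover obtain a b where "shifts W a b"
    using potential_shifts[of W "\<lambda>_. 0" \<theta>] W by auto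
  ultimately show ?thesis
    using that[of W a b] by (simp add: vertex_fun_def diff_def)
qed

lemma coclosed_form_potential:
  assumes opp: "\<And>d. \<eta> (opp G d) = - \<eta> d" and vertex: "\<And>e. (\<Sum>x\<in>tail U e. \<eta> (p x)) = 0"
  obtains N a b where "face_fun N a b" "\<And>e. diff N e = \<eta> (p e)"
proof -
  have "(\<Sum>x\<in>tail U e. \<eta> (p (ccw U x))) = (\<Sum>x\<in>tail U e. \<eta> (p x))" for e
    using sum.reindex_bij_betw[OF bij_betw_orbit[OF bij_ccw[OF U], of e]] tail_self[of e]
    by (simp add: tail_def)
  \<comment> \<open>the increment of \<open>ccw\<close> is forced by \<open>N (opp U (ccw U e)) = N e\<close>, as these darts share their left face\<close>
  then obtain N where N: "\<And>e. N (ccw U e) = N e - \<eta> (p (ccw U e))" "\<And>e. N (opp U e) = N e + \<eta> (p e)"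
    using ex_potential[of "\<lambda>e. \<eta> (p e)" "\<lambda>e. - \<eta> (p (ccw U e))"]
    by (auto simp: opp p_opp vertex sum_negf ccw_face_next[OF U])
  have "N (face_next U e) = N e" for e
    using N(1)[of "face_next U e"] N(2)[of e] by (simp add: ccw_face_next[OF U] p_opp opp)
  moreover obtain a b where "shifts N a b"
    using potential_shifts[of N "\<lambda>d. - \<eta> (ccw G d)" \<eta>] N by (auto simp: p_ccw)
  ultimately show ?thesis
    using that[of N a b] N by (simp add: face_fun_def diff_def)
qed

section \<open>The bilinear relation\<close>

text \<open>
  Each edge consists of two darts, on which \<open>g\<close> takes opposite values.
\<close>

lemma dsum_by_parts:
  assumes \<phi>: "shifts \<phi> 0 0" and g: "shifts g 0 0" "\<And>e. g (opp U e) = - g e"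
  shows "dsum (\<lambda>e. diff \<phi> e * g e) = -2 * dsum (\<lambda>e. \<phi> e * g e)"
proof -
  have "dsum (\<lambda>e. \<phi> (opp U e) * g (opp U e)) = dsum (\<lambda>e. \<phi> e * g e)"
    using dsum_opp[OF shifts_mult[OF \<phi> g(1)]] .
  then have "dsum (\<lambda>e. \<phi> (opp U e) * g e) = - dsum (\<lambda>e. \<phi> e * g e)"
    using dsum_minus[of "\<lambda>e. \<phi> (opp U e) * g e"] by (simp add: g(2))
  then show ?thesis
    by (simp add: diff_def left_diff_distrib dsum_diff)
qed

lemma exact_coclosed_orthogonal:
  assumes W: "vertex_fun W 0 0" and g: "shifts g 0 0" "\<And>e. g (opp U e) = - g e"
    and zero: "\<And>e. (\<Sum>x\<in>tail U e. g x) = 0"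
  shows "dsum (\<lambda>e. diff W e * g e) = 0"
  using dsum_by_parts[of W g] dsum_mult_vertex_sum_zero[of W g] assms
  by (simp add: vertex_fun_def)

lemma diff_face_fun_vertex_sum:
  assumes "face_fun N a b" shows "(\<Sum>x\<in>tail U e. diff N x) = 0"
proof -
  have "N (opp U (ccw U x)) = N x" for x
    using assms face_next_opp_ccw[OF U, of x] by (metis face_fun_def)
  moreover have "(\<Sum>x\<in>tail U e. N (opp U (ccw U x))) = (\<Sum>x\<in>tail U e. N (opp U x))"
    using sum.reindex_bij_betw[OF bij_betw_orbit[OF bij_ccw[OF U], of e], of "\<lambda>x. N (opp U x)"] tail_self[of e]
    by (simp add: tail_def)
  ultimately show ?thesis
    by (simp add: diff_def sum_subtractf)
qed

text \<open>
  Darts come in pairs, so this is a sum over the edges of \<open>G\<close>; the sign is there because the dual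
  form of \<open>N\<close> is its value on the left minus its value on the right, that is \<open>- diff N\<close>.
\<close>

definition pairing :: "('e \<Rightarrow> real) \<Rightarrow> ('e \<Rightarrow> real) \<Rightarrow> real" where
  "pairing W N = - dsum (\<lambda>e. diff W e * diff N e) / 2"

lemma pairing_linear:
  "pairing (\<lambda>e. r * W e + s * W' e) N = r * pairing W N + s * pairing W' N"
  "pairing W (\<lambda>e. r * N e + s * N' e) = r * pairing W N + s * pairing W N'"
proof -
  have "diff (\<lambda>e. r * W e + s * W' e) e * diff N e = r * (diff W e * diff N e) + s * (diff W' e * diff N e)"
    "diff W e * diff (\<lambda>e. r * N e + s * N' e) e = r * (diff W e * diff N e) + s * (diff W e * diff N' e)" for e
    by (simp_all add: diff_linear algebra_simps)
  then show "pairing (\<lambda>e. r * W e + s * W' e) N = r * pairing W N + s * pairing W' N"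
    "pairing W (\<lambda>e. r * N e + s * N' e) = r * pairing W N + s * pairing W N'"
    by (simp_all add: pairing_def dsum_linear field_simps)
qed

lemma pairing_vertex_periods_zero:
  assumes "vertex_fun W 0 0" "face_fun N a b" shows "pairing W N = 0"
  using exact_coclosed_orthogonal[OF assms(1) face_fun_diff[OF assms(2)] diff_opp]
    diff_face_fun_vertex_sum[OF assms(2)]
  by (simp add: pairing_def)

lemma pairing_face_periods_zero:
  assumes "vertex_fun W a b" "face_fun N 0 0" shows "pairing W N = 0"
  using dsum_by_parts[of N "diff W"] dsum_mult_face_sum_zero[of N "diff W"]
    diff_vertex_fun_face_sum[OF assms(1)] vertex_fun_diff[OF assms(1)] assms(2)
  by (simp add: pairing_def diff_opp face_fun_def mult.commute[of "diff W _"])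

text \<open>
  The intersection form is alternating.  If \<open>W\<close> and \<open>N\<close> have the same periods, then \<open>r = N - W\<close> is
  defined on the corners of \<open>G\<close>, and since \<open>r\<close> changes by \<open>- diff W e\<close> along the dart \<open>e\<close> of a face
  boundary, the sum of \<open>r\<^sup>2\<close> telescopes.
\<close>

lemma pairing_same_periods:
  assumes W: "vertex_fun W a b" and N: "face_fun N a b"
  shows "pairing W N = 0"
proof -
  define r where "r e = N e - W e" for e
  have r: "shifts r 0 0" using W N by (simp add: r_def shifts_def vertex_fun_def face_fun_def)
  note w = vertex_fun_diff[OF W]
  have step: "r (face_next U e) = r e - diff W e" for e
    using N vertex_fun_face_next[OF W] by (simp add: r_def diff_def face_fun_def)
  have "(r (face_next U e))\<^sup>2 = (r e)\<^sup>2 - (2 * (r e * diff W e) - diff W e * diff W e)" for e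
    unfolding step by (simp add: power2_eq_square algebra_simps)
  moreover have "dsum (\<lambda>e. (r (face_next U e))\<^sup>2) = dsum (\<lambda>e. (r e)\<^sup>2)"
    using r by (intro dsum_face_next) (simp add: shifts_def)
  ultimately have 1: "2 * dsum (\<lambda>e. r e * diff W e) = dsum (\<lambda>e. diff W e * diff W e)"
    by (simp add: dsum_diff dsum_scale)
  have "diff N e = diff r e + diff W e" for e by (simp add: r_def diff_def)
  then have "dsum (\<lambda>e. diff W e * diff N e) = dsum (\<lambda>e. diff r e * diff W e) + dsum (\<lambda>e. diff W e * diff W e)"
    by (simp add: algebra_simps dsum_add)
  also have "\<dots> = 0"
    using dsum_by_parts[OF r w diff_opp] 1 by simp
  finally show ?thesis by (simp add: pairing_def)
qed

text \<open>
  Averaging over faces transports a function from the vertices to the faces without changing its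
  periods.  This yields functions on faces with arbitrary periods.
\<close>

definition face_average :: "('e \<Rightarrow> real) \<Rightarrow> 'e \<Rightarrow> real" where
  "face_average W e = (\<Sum>x\<in>left U e. W x) / card (left U e)"

lemma face_fun_average:
  assumes W: "vertex_fun W a b" shows "face_fun (face_average W) a b"
proof -
  have shift: "face_average W (g e) = face_average W e + t"
    if g: "deck_transformation U p g" and t: "\<And>x. W (g x) = W x + t" for g e t
  proof -
    have inj: "inj_on g A" for A
      using g by (meson bij_is_inj deck_transformation_def inj_on_subset subset_UNIV)
    have "(\<Sum>x\<in>left U (g e). W x) = (\<Sum>x\<in>left U e. W x) + card (left U e) * t"
      unfolding deck_left[OF g, symmetric] sum.reindex[OF inj] by (simp add: t sum.distrib)
    moreover have "card (left U (g e)) = card (left U e)"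
      unfolding deck_left[OF g, symmetric] using inj by (rule card_image)
    moreover have "card (left U e) > 0"
      using left_self finite_left by (auto simp: card_gt_0_iff)
    ultimately show ?thesis by (simp add: face_average_def field_simps)
  qed
  have "left U (face_next U e) = left U e" for e
    using self_in_orbit_step left_self by (metis left_def)
  then have "face_average W (face_next U e) = face_average W e" for e
    by (simp add: face_average_def)
  then show ?thesis
    using W shift[OF gen_deck(1)] shift[OF gen_deck(2)]
    by (simp add: face_fun_def vertex_fun_def shifts_def)
qed

lemma vertex_fun_some:
  assumes "vertex_fun W a b" shows "W (SOME x. x \<in> tail U e) = W e"
proof -
  have "x \<in> tail U e \<Longrightarrow> W x = W e" for x
    unfolding tail_def
    by (induction rule: orbit.induct) (use assms in \<open>simp_all add: vertex_fun_def\<close>)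
  then show ?thesis using tail_self by (metis someI)
qed

lemma face_fun_some:
  assumes "face_fun N a b" shows "N (SOME x. x \<in> left U e) = N e"
proof -
  have "x \<in> left U e \<Longrightarrow> N x = N e" for x
    unfolding left_def
    by (induction rule: orbit.induct) (use assms in \<open>simp_all add: face_fun_def\<close>)
  then show ?thesis using left_self by (metis someI)
qed

lemma sum_list_vertex_walk:
  assumes W: "vertex_fun W a b" and walk: "walk U v ds (\<gamma>1 ` v)" and v: "v \<in> vertices U"
  shows "(\<Sum>d\<leftarrow>ds. diff W d) = a"
proof -
  obtain e where e: "v = tail U e" using v by (auto simp: vertices_def)
  let ?w = "\<lambda>v. W (SOME x. x \<in> v)"
  have "(\<Sum>d\<leftarrow>ds. ?w (head U d) - ?w (tail U d)) = ?w (\<gamma>1 ` v) - ?w v"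
    using walk unfolding walk_def by (rule sum_list_walk)
  then show ?thesis
    using W by (simp add: e deck_tail[OF gen_deck(1)] head_def vertex_fun_some[OF W] vertex_fun_def
        shifts_def flip: diff_def)
qed

lemma sum_list_dual_walk:
  assumes N: "face_fun N a b" and walk: "dual_walk U f ds (\<gamma>2 ` f)" and f: "f \<in> faces U"
  shows "(\<Sum>d\<leftarrow>ds. - diff N d) = b"
proof -
  obtain e where e: "f = left U e" using f by (auto simp: faces_def)
  let ?n = "\<lambda>f. N (SOME x. x \<in> f)"
  have "(\<Sum>d\<leftarrow>ds. ?n (left U d) - ?n (right U d)) = ?n (\<gamma>2 ` f) - ?n f"
    using walk unfolding dual_walk_def by (rule sum_list_walk)
  then show ?thesis
    using N by (simp add: e deck_left[OF gen_deck(2)] right_def face_fun_some[OF N] face_fun_def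
        shifts_def diff_def)
qed

lemma sum_crossing:
  fixes g :: "'d \<Rightarrow> real"
  shows "(\<Sum>x\<in>A. of_int (crossing G x y) * g x) =
    (if y \<in> A then g y else 0) - (if opp G y \<in> A then g (opp G y) else 0)"
proof -
  have "opp G y \<noteq> y" using G by (simp add: combinatorial_map_def)
  then have "of_int (crossing G x y) * g x = (if x = y then g x else 0) - (if x = opp G y then g x else 0)" for x
    by (auto simp: crossing_def)
  then show ?thesis by (simp add: sum_subtractf)
qed

text \<open>
  The crossing form of the dual walk that represents \<open>\<gamma>2\<close> is Poincare dual to \<open>\<gamma>2\<close>: pairing \<open>N\<close> with
  it adds up the increments of \<open>N\<close> along the walk.  It is closed because the walk closes up in \<open>G\<close>,
  and its sum along a walk that represents \<open>\<gamma>1\<close> is the intersection number.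
\<close>

lemma ex_dual_form:
  obtains W t where "vertex_fun W 1 t" "\<And>N n1 n2. face_fun N n1 n2 \<Longrightarrow> pairing W N = n2"
proof -
  obtain v f as bs where v: "v \<in> vertices U" and f: "f \<in> faces U"
    and as: "walk U v as (\<gamma>1 ` v)" and bs: "dual_walk U f bs (\<gamma>2 ` f)"
    and int: "(\<Sum>a\<leftarrow>as. \<Sum>b\<leftarrow>bs. crossing G (p a) (p b)) = 1"
    using gens unfolding positive_generators_def has_intersection_number_def by blast
  define \<beta> :: "'d \<Rightarrow> real" where "\<beta> d = (\<Sum>b\<leftarrow>bs. of_int (crossing G d (p b)))" for d
  have sum_\<beta>: "(\<Sum>d\<in>A. \<beta> d * g d) = (\<Sum>b\<leftarrow>bs. \<Sum>d\<in>A. of_int (crossing G d (p b)) * g d)" for A g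
    unfolding \<beta>_def by (induction bs) (simp_all add: distrib_right sum.distrib)
  have "\<beta> (opp G d) = - \<beta> d" for d
  proof -
    have "crossing G (opp G d) y = - crossing G d y" for y
    proof -
      have "opp G d = y \<longleftrightarrow> d = opp G y" "opp G d = opp G y \<longleftrightarrow> d = y"
        using opp_opp[OF G] by metis+
      moreover have "opp G y \<noteq> y" using G by (simp add: combinatorial_map_def)
      ultimately show ?thesis by (auto simp: crossing_def)
    qed
    then show ?thesis unfolding \<beta>_def by (induction bs) auto
  qed
  moreover have "(\<Sum>d\<in>left G d0. \<beta> d) = 0" for d0
  proof -
    let ?\<chi> = "\<lambda>f. (if p ` f = left G d0 then 1 else 0 :: real)"
    have mem: "y \<in> left G d0 \<longleftrightarrow> left G y = left G d0" for y
    proof -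
      have self: "x \<in> left G x" for x
        using mem_orbit_self[OF bij_face_next[OF G], of x] by (simp add: left_def)
      show ?thesis using self[of y] self[of d0] orbit_eq_if_mem[of d0 "face_next G" y]
        by (auto simp: left_def)
    qed
    have "(\<Sum>d\<in>left G d0. \<beta> d) = (\<Sum>b\<leftarrow>bs. ?\<chi> (left U b) - ?\<chi> (right U b))"
      using sum_\<beta>[of "\<lambda>_. 1" "left G d0"] sum_crossing[where g = "\<lambda>_. 1" and A = "left G d0"]
      by (simp add: image_left right_def p_opp mem)
    also have "\<dots> = ?\<chi> (\<gamma>2 ` f) - ?\<chi> f"
      using bs unfolding dual_walk_def by (rule sum_list_walk)
    also have "p ` \<gamma>2 ` f = p ` f"
      by (simp add: image_image gen_commute)
    finally show ?thesis by simp
  qed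
  ultimately have "closed_1form G \<beta>"
    by (auto simp: closed_1form_def faces_def)
  then obtain W s t where W: "vertex_fun W s t" "\<And>e. diff W e = \<beta> (p e)"
    using closed_form_potential by blast
  have "s = (\<Sum>a\<leftarrow>as. \<beta> (p a))"
    using sum_list_vertex_walk[OF W(1) as v] by (simp add: W(2))
  also have "\<dots> = of_int (\<Sum>a\<leftarrow>as. \<Sum>b\<leftarrow>bs. crossing G (p a) (p b))"
  proof -
    have "\<beta> d = of_int (\<Sum>b\<leftarrow>bs. crossing G d (p b))" for d
      unfolding \<beta>_def by (induction bs) auto
    then show ?thesis by (induction as) auto
  qed
  finally have "s = 1" using int by simp
  moreover have "pairing W N = n2" if N: "face_fun N n1 n2" for N n1 n2
  proof -
    note inv = face_fun_diff[OF N]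
    define \<nu> where "\<nu> d = diff N (inv_into UNIV p d)" for d
    have \<nu>: "\<nu> (p e) = diff N e" for e
      using lift_invariant[OF inv] by (simp add: \<nu>_def)
    have \<nu>_opp: "\<nu> (opp G d) = - \<nu> d" for d
      using \<nu>[of "opp U (inv_into UNIV p d)"] by (simp add: p_opp diff_opp \<nu>_def)
    have "dsum (\<lambda>e. diff W e * diff N e) = (\<Sum>d\<in>UNIV. \<beta> d * \<nu> d)"
      using dsum_p[of "\<lambda>d. \<beta> d * \<nu> d"] by (simp add: W(2) \<nu>)
    also have "\<dots> = (\<Sum>b\<leftarrow>bs. 2 * diff N b)"
      by (simp add: sum_\<beta> sum_crossing \<nu>_opp \<nu>)
    also have "\<dots> = -2 * (\<Sum>b\<leftarrow>bs. - diff N b)"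
      by (induction bs) auto
    also have "\<dots> = -2 * n2"
      using sum_list_dual_walk[OF N bs f] by simp
    finally show ?thesis by (simp add: pairing_def)
  qed
  ultimately show ?thesis using that W(1) by blast
qed

text \<open>
  The pairing depends only on the periods and is alternating in them, so it is a multiple of the
  determinant; the crossing form of \<open>\<gamma>2\<close> shows that the factor is the intersection number 1.
\<close>

theorem bilinear_relation:
  assumes u1: "vertex_fun u1 1 0" and u2: "vertex_fun u2 0 1"
    and W: "vertex_fun W a1 a2" and N: "face_fun N n1 n2"
  shows "pairing W N = a1 * n2 - a2 * n1"
proof -
  let ?N1 = "face_average u1" and ?N2 = "face_average u2"
  note N1 = face_fun_average[OF u1] and N2 = face_fun_average[OF u2]
  have vertex: "pairing V M = b1 * pairing u1 M + b2 * pairing u2 M"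
    if V: "vertex_fun V b1 b2" and M: "face_fun M m1 m2" for V M b1 b2 m1 m2
  proof -
    let ?V = "\<lambda>e. b1 * u1 e + b2 * u2 e"
    have "vertex_fun ?V b1 b2" using vertex_fun_linear[OF u1 u2, of b1 b2] by simp
    from vertex_fun_linear[OF V this, of 1 "-1"]
    have "pairing (\<lambda>e. 1 * V e + (-1) * ?V e) M = 0"
      by (intro pairing_vertex_periods_zero[OF _ M]) simp
    then show ?thesis unfolding pairing_linear by simp
  qed
  have face: "pairing V N = n1 * pairing V ?N1 + n2 * pairing V ?N2"
    if V: "vertex_fun V b1 b2" for V b1 b2
  proof -
    let ?N = "\<lambda>e. n1 * ?N1 e + n2 * ?N2 e"
    have "face_fun ?N n1 n2" using face_fun_linear[OF N1 N2, of n1 n2] by simp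
    from face_fun_linear[OF N this, of 1 "-1"]
    have "pairing V (\<lambda>e. 1 * N e + (-1) * ?N e) = 0"
      by (intro pairing_face_periods_zero[OF V]) simp
    then show ?thesis unfolding pairing_linear by simp
  qed
  have 11: "pairing u1 ?N1 = 0" and 22: "pairing u2 ?N2 = 0"
    using pairing_same_periods u1 u2 N1 N2 by blast+
  have "pairing (\<lambda>e. 1 * u1 e + 1 * u2 e) (\<lambda>e. 1 * ?N1 e + 1 * ?N2 e) = 0"
    using pairing_same_periods[OF vertex_fun_linear[OF u1 u2, of 1 1]] face_fun_linear[OF N1 N2, of 1 1]
    by simp
  then have 21: "pairing u2 ?N1 = - pairing u1 ?N2"
    unfolding pairing_linear using 11 22 by simp
  obtain V t where V: "vertex_fun V 1 t" "\<And>N n1 n2. face_fun N n1 n2 \<Longrightarrow> pairing V N = n2"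
    by (rule ex_dual_form) metis
  have "pairing u1 ?N2 = 1"
    using vertex[OF V(1) N2] V(2)[OF N2] 22 by simp
  then show ?thesis
    using vertex[OF W N] face[OF u1] face[OF u2] 11 22 21 by simp
qed

end

section \<open>The energy form\<close>

locale weighted_torus_cover = torus_cover G U p \<gamma>1 \<gamma>2
  for G :: "('d::finite) cmap" and U :: "'e cmap" and p :: "'e \<Rightarrow> 'd" and \<gamma>1 \<gamma>2 :: "'e \<Rightarrow> 'e" +
  fixes c :: "'d \<Rightarrow> real"
  assumes c_weight: "edge_weight G c" and c_nondeg: "nondegenerate G c"
begin

lemma c_opp: "c (opp G d) = c d"
  using c_weight by (simp add: edge_weight_def)

definition energy_form :: "('e \<Rightarrow> real) \<Rightarrow> ('e \<Rightarrow> real) \<Rightarrow> real" where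
  "energy_form W W' = dsum (\<lambda>e. c (p e) * (diff W e * diff W' e)) / 2"

lemma energy_form_commute: "energy_form W W' = energy_form W' W"
  by (simp add: energy_form_def mult.commute)

lemma energy_form_linear:
  "energy_form (\<lambda>e. r * W e + s * W' e) V = r * energy_form W V + s * energy_form W' V"
proof -
  have "c (p e) * (diff (\<lambda>e. r * W e + s * W' e) e * diff V e) =
      r * (c (p e) * (diff W e * diff V e)) + s * (c (p e) * (diff W' e * diff V e))" for e
    by (simp add: diff_linear algebra_simps)
  then show ?thesis by (simp add: energy_form_def dsum_linear field_simps)
qed

lemma energy_form_sum_square:
  "energy_form (\<lambda>e. r * W e + s * V e) (\<lambda>e. r * W e + s * V e) =
    r\<^sup>2 * energy_form W W + 2 * r * s * energy_form W V + s\<^sup>2 * energy_form V V"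
  by (simp add: energy_form_linear energy_form_commute[of _ "\<lambda>e. r * W e + s * V e"]
      energy_form_commute[of V W] power2_eq_square algebra_simps)

lemma
  assumes W: "vertex_fun W a b"
  shows energy_form_nonneg: "energy_form W W \<ge> 0"
    and energy_form_definite: "energy_form W W = 0 \<Longrightarrow> diff W e = 0"
proof -
  define \<omega> where "\<omega> d = diff W (inv_into UNIV p d)" for d
  have \<omega>: "\<omega> (p e) = diff W e" for e
    unfolding \<omega>_def by (rule lift_invariant[OF vertex_fun_diff[OF W]])
  have "closed_1form G \<omega>"
    unfolding closed_1form_def
  proof (intro conjI allI ballI)
    show "\<omega> (opp G d) = - \<omega> d" for d
      using \<omega>[of "opp U (inv_into UNIV p d)"] by (simp add: p_opp diff_opp \<omega>_def)
    fix f assume "f \<in> faces G"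
    then obtain d where "f = left G d" by (auto simp: faces_def)
    then show "(\<Sum>d\<in>f. \<omega> d) = 0"
      using sum_left[of \<omega> "inv_into UNIV p d"] by (simp add: \<omega> diff_vertex_fun_face_sum[OF W])
  qed
  moreover have "energy_form W W = edge_sum (\<lambda>d. c d * (\<omega> d)\<^sup>2)"
    using dsum_p[of "\<lambda>d. c d * (\<omega> d)\<^sup>2"]
    by (simp add: energy_form_def edge_sum_def \<omega> power2_eq_square)
  ultimately have "energy_form W W \<ge> 0" "energy_form W W = 0 \<Longrightarrow> \<omega> d = 0" for d
    using c_nondeg unfolding nondegenerate_def by auto
  then show "energy_form W W \<ge> 0" "energy_form W W = 0 \<Longrightarrow> diff W e = 0"
    using \<omega>[of e] by metis+
qed

definition harmonic_fun :: "('e \<Rightarrow> real) \<Rightarrow> bool" where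
  "harmonic_fun W \<longleftrightarrow> (\<forall>e. (\<Sum>x\<in>tail U e. c (p x) * diff W x) = 0)"

text \<open>
  For harmonic \<open>W\<close> the form \<open>c dW\<close> is coclosed, hence orthogonal to exact forms.
\<close>

lemma harmonic_orthogonal:
  assumes W: "vertex_fun W a b" "harmonic_fun W" and g: "vertex_fun g 0 0"
  shows "energy_form W g = 0"
proof -
  have "dsum (\<lambda>e. diff g e * (c (p e) * diff W e)) = 0"
  proof (rule exact_coclosed_orthogonal[OF g])
    show "shifts (\<lambda>e. c (p e) * diff W e) 0 0"
      using vertex_fun_diff[OF W(1)] by (simp add: shifts_def gen_commute)
    show "c (p (opp U e)) * diff W (opp U e) = - (c (p e) * diff W e)" for e
      by (simp add: p_opp c_opp diff_opp)
  qed (use W(2) in \<open>simp add: harmonic_fun_def\<close>)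
  then show ?thesis by (simp add: energy_form_def mult.left_commute mult.commute)
qed

text \<open>
  Pythagoras: \<open>W\<close> differs from the harmonic function with the same periods by an invariant function,
  which is orthogonal to it.
\<close>

lemma energy_form_harmonic_decomposition:
  assumes u: "vertex_fun u a1 a2" "harmonic_fun u" and v: "vertex_fun v b1 b2" "harmonic_fun v"
    and W: "vertex_fun W (\<alpha> * a1 + \<beta> * b1) (\<alpha> * a2 + \<beta> * b2)"
  obtains g where "vertex_fun g 0 0" "\<And>e. W e = \<alpha> * u e + \<beta> * v e + g e"
    "energy_form W W = \<alpha>\<^sup>2 * energy_form u u + 2 * \<alpha> * \<beta> * energy_form u v + \<beta>\<^sup>2 * energy_form v v
      + energy_form g g"
proof -
  let ?w = "\<lambda>e. \<alpha> * u e + \<beta> * v e"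
  define g where "g = (\<lambda>e. 1 * W e + (-1) * ?w e)"
  have g: "vertex_fun g 0 0"
    using vertex_fun_linear[OF W vertex_fun_linear[OF u(1) v(1), of \<alpha> \<beta>], of 1 "-1"]
    by (simp add: g_def)
  have W_eq: "W = (\<lambda>e. 1 * ?w e + 1 * g e)" by (simp add: g_def)
  have "energy_form ?w g = 0"
    using harmonic_orthogonal[OF u g] harmonic_orthogonal[OF v g] by (simp only: energy_form_linear)
  moreover have "energy_form W W = 1\<^sup>2 * energy_form ?w ?w + 2 * 1 * 1 * energy_form ?w g + 1\<^sup>2 * energy_form g g"
    by (subst (1 2) W_eq) (rule energy_form_sum_square)
  ultimately have "energy_form W W = energy_form ?w ?w + energy_form g g" by simp
  then show ?thesis
    using that[OF g] energy_form_sum_square[of \<alpha> u \<beta> v] by (simp add: g_def)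
qed

section \<open>Maps to the Euclidean torus\<close>

definition re_part :: "('e \<Rightarrow> 'e set) \<Rightarrow> ('e set \<Rightarrow> complex) \<Rightarrow> 'e \<Rightarrow> real" where
  "re_part T h e = Re (h (T e))"

definition im_part :: "('e \<Rightarrow> 'e set) \<Rightarrow> ('e set \<Rightarrow> complex) \<Rightarrow> 'e \<Rightarrow> real" where
  "im_part T h e = Im (h (T e))"

lemma dirichlet_energy_eq:
  "dirichlet_energy U p c h =
    (energy_form (re_part (tail U) h) (re_part (tail U) h) +
     energy_form (im_part (tail U) h) (im_part (tail U) h)) / 2"
proof -
  let ?u = "re_part (tail U) h" and ?v = "im_part (tail U) h"
  have "(cmod (h (head U e) - h (tail U e)))\<^sup>2 = diff ?u e * diff ?u e + diff ?v e * diff ?v e" for e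
    unfolding cmod_power2 by (simp add: re_part_def im_part_def diff_def head_def power2_eq_square)
  then show ?thesis
    by (simp add: dirichlet_energy_def edge_sum_def energy_form_def dsum_def distrib_left sum.distrib Let_def)
qed

lemma has_periods_iff:
  assumes "Im \<tau> > 0" and T: "\<And>e. \<gamma>1 ` T e = T (\<gamma>1 e)" "\<And>e. \<gamma>2 ` T e = T (\<gamma>2 e)"
  shows "has_periods \<gamma>1 \<gamma>2 (range T) k \<tau> h \<longleftrightarrow>
    shifts (re_part T h) (k / sqrt (Im \<tau>)) (k * Re \<tau> / sqrt (Im \<tau>)) \<and>
    shifts (im_part T h) 0 (k * sqrt (Im \<tau>))"
proof -
  have "k * Im \<tau> / sqrt (Im \<tau>) = k * sqrt (Im \<tau>)"
    using real_div_sqrt[of "Im \<tau>"] assms(1) by (simp flip: times_divide_eq_right)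
  then show ?thesis
    unfolding has_periods_def shifts_def re_part_def im_part_def
    by (auto simp: T complex_eq_iff)
qed

lemma tail_ccw: "tail U (ccw U e) = tail U e"
  and left_face_next: "left U (face_next U e) = left U e"
  using self_in_orbit_step tail_self left_self unfolding tail_def left_def by metis+

lemma straight_line_map_iff:
  assumes "Im \<tau> > 0"
  shows "straight_line_map U \<gamma>1 \<gamma>2 \<tau> h \<longleftrightarrow>
    vertex_fun (re_part (tail U) h) (1 / sqrt (Im \<tau>)) (Re \<tau> / sqrt (Im \<tau>)) \<and>
    vertex_fun (im_part (tail U) h) 0 (sqrt (Im \<tau>))"
  using has_periods_iff[OF assms, of "tail U" 1 h] gen_deck
  by (simp add: straight_line_map_def vertex_fun_def vertices_def deck_tail re_part_def im_part_def tail_ccw)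

lemma projects_to_iff:
  assumes "Im \<tau> > 0"
  shows "projects_to U \<gamma>1 \<gamma>2 k \<tau> hc \<longleftrightarrow>
    face_fun (re_part (left U) hc) (k / sqrt (Im \<tau>)) (k * Re \<tau> / sqrt (Im \<tau>)) \<and>
    face_fun (im_part (left U) hc) 0 (k * sqrt (Im \<tau>))"
  using has_periods_iff[OF assms, of "left U" k hc] gen_deck
  by (simp add: projects_to_def face_fun_def faces_def deck_left re_part_def im_part_def left_face_next)

lemma conjugate_map_iff:
  "conjugate_map U p c h hc \<longleftrightarrow>
    (\<forall>e. diff (re_part (left U) hc) e = c (p e) * diff (im_part (tail U) h) e) \<and>
    (\<forall>e. diff (im_part (left U) hc) e = - (c (p e) * diff (re_part (tail U) h) e))"
  unfolding conjugate_map_def complex_eq_iff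
  by (auto simp: diff_def re_part_def im_part_def head_def right_def algebra_simps)

lemma harmonic_iff:
  "harmonic U p c h \<longleftrightarrow> harmonic_fun (re_part (tail U) h) \<and> harmonic_fun (im_part (tail U) h)"
proof -
  have "x \<in> tail U e \<Longrightarrow> tail U x = tail U e" for x e
    unfolding tail_def by (rule orbit_eq_if_mem) (use tail_self in \<open>simp_all add: tail_def\<close>)
  then have "(\<Sum>x\<in>tail U e. complex_of_real (c (p x)) * (h (head U x) - h (tail U e))) =
      (\<Sum>x\<in>tail U e. complex_of_real (c (p x)) * (h (head U x) - h (tail U x)))" for e
    by (intro sum.cong) auto
  then show ?thesis
    by (auto simp: harmonic_def harmonic_fun_def vertices_def complex_eq_iff diff_def
        re_part_def im_part_def head_def)
qed

lemma ex_straight_line_map: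
  assumes "Im \<tau> > 0" and W: "vertex_fun W (1 / sqrt (Im \<tau>)) (Re \<tau> / sqrt (Im \<tau>))"
    and V: "vertex_fun V 0 (sqrt (Im \<tau>))"
  obtains h where "straight_line_map U \<gamma>1 \<gamma>2 \<tau> h"
    "dirichlet_energy U p c h = (energy_form W W + energy_form V V) / 2"
proof -
  define h where "h v = Complex (W (SOME x. x \<in> v)) (V (SOME x. x \<in> v))" for v
  have "re_part (tail U) h = W" "im_part (tail U) h = V"
    by (auto simp: re_part_def im_part_def h_def vertex_fun_some[OF W] vertex_fun_some[OF V])
  then show ?thesis
    using that[of h] straight_line_map_iff[OF assms(1)] W V by (simp add: dirichlet_energy_eq)
qed

end

section \<open>The two characterizations\<close>

locale harmonic_torus_map = weighted_torus_cover G U p \<gamma>1 \<gamma>2 c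
  for G :: "('d::finite) cmap" and U :: "'e cmap" and p :: "'e \<Rightarrow> 'd" and \<gamma>1 \<gamma>2 :: "'e \<Rightarrow> 'e"
    and c :: "'d \<Rightarrow> real" +
  fixes \<tau> :: complex and h :: "'e set \<Rightarrow> complex" and k :: real
  assumes \<tau>: "Im \<tau> > 0" and h_map: "straight_line_map U \<gamma>1 \<gamma>2 \<tau> h" and h_harmonic: "harmonic U p c h"
    and k: "k > 0"
begin

definition "u = re_part (tail U) h"
definition "v = im_part (tail U) h"
definition "s = sqrt (Im \<tau>)"

lemma s: "s > 0"
  using \<tau> by (simp add: s_def)

lemma u: "vertex_fun u (1 / s) (Re \<tau> / s)" and v: "vertex_fun v 0 s"
  using h_map straight_line_map_iff[OF \<tau>] by (simp_all add: u_def v_def s_def)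

lemma u_harmonic: "harmonic_fun u" and v_harmonic: "harmonic_fun v"
  using h_harmonic harmonic_iff by (simp_all add: u_def v_def)

lemma dirichlet_energy_h: "dirichlet_energy U p c h = (energy_form u u + energy_form v v) / 2"
  by (simp add: dirichlet_energy_eq u_def v_def)

definition conformal_energy :: bool where
  "conformal_energy \<longleftrightarrow> energy_form u u = k \<and> energy_form v v = k \<and> energy_form u v = 0"

text \<open>
  As \<open>Im \<tau> \<noteq> 0\<close>, the periods of \<open>u\<close> and \<open>v\<close> are independent, so that combinations of \<open>u\<close> and \<open>v\<close>
  serve as the basis that the bilinear relation asks for.
\<close>

lemma bilinear:
  assumes W: "vertex_fun W a1 a2" and N: "face_fun N n1 n2"
  shows "pairing W N = a1 * n2 - a2 * n1"
proof (rule bilinear_relation[OF _ _ W N])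
  show "vertex_fun (\<lambda>e. s * u e + (- Re \<tau> / s) * v e) 1 0"
    using vertex_fun_linear[OF u v, of s "- Re \<tau> / s"] s by simp
  show "vertex_fun (\<lambda>e. 0 * u e + (1 / s) * v e) 0 1"
    using vertex_fun_linear[OF u v, of 0 "1 / s"] s by simp
qed

lemma pairing_conjugate:
  assumes "\<And>e. diff N e = r * (c (p e) * diff V e)"
  shows "pairing W N = - r * energy_form W V"
proof -
  have eq: "diff W e * diff N e = r * (c (p e) * (diff W e * diff V e))" for e
    by (simp add: assms)
  show ?thesis unfolding pairing_def energy_form_def eq dsum_scale by simp
qed

text \<open>
  The real and imaginary parts of the conjugate map are potentials of \<open>- c dv\<close> and \<open>c du\<close>.  Pairing
  them with \<open>u\<close> and \<open>v\<close> gives the entries of the energy form on the one hand and, by the bilinear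
  relation, determinants of periods on the other.  As the periods of \<open>u\<close> and \<open>v\<close> are independent,
  each side determines the other.
\<close>

lemma conjugate_projects_iff:
  "(\<exists>hc. conjugate_map U p c h hc \<and> projects_to U \<gamma>1 \<gamma>2 k \<tau> hc) \<longleftrightarrow> conformal_energy"
proof
  assume "\<exists>hc. conjugate_map U p c h hc \<and> projects_to U \<gamma>1 \<gamma>2 k \<tau> hc"
  then obtain hc where hc: "conjugate_map U p c h hc" "projects_to U \<gamma>1 \<gamma>2 k \<tau> hc" by blast
  define M where "M = re_part (left U) hc"
  define N where "N = im_part (left U) hc"
  have M: "face_fun M (k / s) (k * Re \<tau> / s)" and N: "face_fun N 0 (k * s)"
    using hc(2) projects_to_iff[OF \<tau>] by (simp_all add: M_def N_def s_def)
  have MN: "pairing W M = - energy_form W v" "pairing W N = energy_form W u" for W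
    using hc(1) pairing_conjugate[of M 1 v W] pairing_conjugate[of N "-1" u W]
    by (simp_all add: conjugate_map_iff M_def N_def u_def v_def)
  show conformal_energy
    using bilinear[OF u N] bilinear[OF v N] bilinear[OF v M] s
    by (simp add: conformal_energy_def MN energy_form_commute[of v u])
next
  assume E: conformal_energy
  have ex: "\<exists>N n1 n2. face_fun N n1 n2 \<and> (\<forall>e. diff N e = r * (c (p e) * diff V e))"
    if V: "vertex_fun V b1 b2" "harmonic_fun V" for V b1 b2 r
  proof -
    define \<eta> where "\<eta> d = r * (c d * diff V (inv_into UNIV p d))" for d
    have \<eta>: "\<eta> (p e) = r * (c (p e) * diff V e)" for e
      using lift_invariant[OF vertex_fun_diff[OF V(1)]] by (simp add: \<eta>_def)
    have "\<eta> (opp G d) = - \<eta> d" for d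
      using \<eta>[of "opp U (inv_into UNIV p d)"] by (simp add: p_opp c_opp diff_opp \<eta>_def)
    moreover have "(\<Sum>x\<in>tail U e. \<eta> (p x)) = 0" for e
      using V(2) by (simp add: \<eta> harmonic_fun_def flip: sum_distrib_left)
    ultimately show ?thesis
      using coclosed_form_potential[of \<eta>] unfolding \<eta> by metis
  qed
  obtain M m1 m2 where M: "face_fun M m1 m2" "\<And>e. diff M e = 1 * (c (p e) * diff v e)"
    using ex[OF v v_harmonic, of 1] by blast
  obtain N n1 n2 where N: "face_fun N n1 n2" "\<And>e. diff N e = -1 * (c (p e) * diff u e)"
    using ex[OF u u_harmonic, of "-1"] by blast
  have MN: "pairing W M = - energy_form W v" "pairing W N = energy_form W u" for W
    using pairing_conjugate[of M 1 v W] pairing_conjugate[of N "-1" u W] M(2) N(2) by simp_all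
  have N_per: "n1 = 0" "n2 = k * s"
    using bilinear[OF u N(1)] bilinear[OF v N(1)] E s
    by (auto simp: MN conformal_energy_def energy_form_commute[of v u] field_simps)
  have M_per: "m1 = k / s" "m2 = k * Re \<tau> / s"
    using bilinear[OF u M(1)] bilinear[OF v M(1)] E s
    by (auto simp: MN conformal_energy_def field_simps)
  define hc where "hc f = Complex (M (SOME x. x \<in> f)) (N (SOME x. x \<in> f))" for f
  have hc: "re_part (left U) hc = M" "im_part (left U) hc = N"
    by (auto simp: re_part_def im_part_def hc_def face_fun_some[OF M(1)] face_fun_some[OF N(1)])
  have "conjugate_map U p c h hc"
    using M(2) N(2) by (simp add: conjugate_map_iff hc u_def v_def)
  moreover have "projects_to U \<gamma>1 \<gamma>2 k \<tau> hc"
    using M(1) N(1) by (simp add: projects_to_iff[OF \<tau>] hc M_per N_per s_def)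
  ultimately show "\<exists>hc. conjugate_map U p c h hc \<and> projects_to U \<gamma>1 \<gamma>2 k \<tau> hc" by blast
qed

text \<open>
  In the basis \<open>u, v\<close> of harmonic functions, the harmonic part of a map to another torus is the
  matrix \<open>(\<alpha>, \<beta>; 0, 1 / \<alpha>)\<close> applied to \<open>h\<close>.  The matrix is triangular because the \<open>\<gamma>1\<close>-period of
  both maps is real, and has determinant 1 because both tori have unit area.
\<close>

lemma energy_decomposition:
  assumes \<tau>': "Im \<tau>' > 0" and h': "straight_line_map U \<gamma>1 \<gamma>2 \<tau>' h'"
  obtains \<alpha> \<beta> g1 g2 where "\<alpha> > 0" "\<alpha> = s / sqrt (Im \<tau>')" "\<beta> = (Re \<tau>' - Re \<tau>) / (s * sqrt (Im \<tau>'))"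
    "vertex_fun g1 0 0" "vertex_fun g2 0 0"
    "\<And>e. re_part (tail U) h' e = \<alpha> * u e + \<beta> * v e + g1 e"
    "\<And>e. im_part (tail U) h' e = 1 / \<alpha> * v e + g2 e"
    "2 * dirichlet_energy U p c h' = \<alpha>\<^sup>2 * energy_form u u + 2 * \<alpha> * \<beta> * energy_form u v
      + (\<beta>\<^sup>2 + (1 / \<alpha>)\<^sup>2) * energy_form v v + energy_form g1 g1 + energy_form g2 g2"
proof -
  let ?u = "re_part (tail U) h'" and ?v = "im_part (tail U) h'"
  define s' where "s' = sqrt (Im \<tau>')"
  have s': "s' > 0" using \<tau>' by (simp add: s'_def)
  define \<alpha> where "\<alpha> = s / s'"
  define \<beta> where "\<beta> = (Re \<tau>' - Re \<tau>) / (s * s')"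
  have \<alpha>: "\<alpha> > 0" using s s' by (simp add: \<alpha>_def)
  have u': "vertex_fun ?u (1 / s') (Re \<tau>' / s')" and v': "vertex_fun ?v 0 s'"
    using h' straight_line_map_iff[OF \<tau>'] by (simp_all add: s'_def)
  have "1 / s' = \<alpha> * (1 / s) + \<beta> * 0" "Re \<tau>' / s' = \<alpha> * (Re \<tau> / s) + \<beta> * s"
    "s' = 0 * (Re \<tau> / s) + 1 / \<alpha> * s"
    using s s' by (simp_all add: \<alpha>_def \<beta>_def field_simps)
  then have u'': "vertex_fun ?u (\<alpha> * (1 / s) + \<beta> * 0) (\<alpha> * (Re \<tau> / s) + \<beta> * s)"
    and v'': "vertex_fun ?v (0 * (1 / s) + 1 / \<alpha> * 0) (0 * (Re \<tau> / s) + 1 / \<alpha> * s)"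
    using u' v' by (metis, metis mult_zero_left mult_zero_right add_0)
  obtain g1 where g1: "vertex_fun g1 0 0" "\<And>e. ?u e = \<alpha> * u e + \<beta> * v e + g1 e"
      "energy_form ?u ?u = \<alpha>\<^sup>2 * energy_form u u + 2 * \<alpha> * \<beta> * energy_form u v
        + \<beta>\<^sup>2 * energy_form v v + energy_form g1 g1"
    using energy_form_harmonic_decomposition[OF u u_harmonic v v_harmonic u''] by metis
  obtain g2 where g2: "vertex_fun g2 0 0" "\<And>e. ?v e = 0 * u e + 1 / \<alpha> * v e + g2 e"
      "energy_form ?v ?v = 0\<^sup>2 * energy_form u u + 2 * 0 * (1 / \<alpha>) * energy_form u v
        + (1 / \<alpha>)\<^sup>2 * energy_form v v + energy_form g2 g2"
    using energy_form_harmonic_decomposition[OF u u_harmonic v v_harmonic v''] by metis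
  show ?thesis
    by (rule that[OF \<alpha> _ _ g1(1) g2(1) g1(2)])
       (simp_all add: \<alpha>_def \<beta>_def s'_def g2(2) dirichlet_energy_eq g1(3) g2(3) algebra_simps)
qed

text \<open>
  Conversely every such matrix occurs, with modulus \<open>Re \<tau> + \<beta> s\<^sup>2 / \<alpha> + \<i> s\<^sup>2 / \<alpha>\<^sup>2\<close>.
\<close>

lemma ex_deformed_map:
  assumes "\<alpha> > 0"
  obtains \<tau>' h' where "(\<tau>', h') \<in> energy_domain U \<gamma>1 \<gamma>2"
    "2 * dirichlet_energy U p c h' = \<alpha>\<^sup>2 * energy_form u u + 2 * \<alpha> * \<beta> * energy_form u v
      + (\<beta>\<^sup>2 + (1 / \<alpha>)\<^sup>2) * energy_form v v"
proof -
  define s' where "s' = s / \<alpha>"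
  have s': "s' > 0" using s assms by (simp add: s'_def)
  define \<tau>' where "\<tau>' = Complex (Re \<tau> + \<beta> * s * s') (s' * s')"
  let ?u = "\<lambda>e. \<alpha> * u e + \<beta> * v e" and ?v = "\<lambda>e. 0 * u e + 1 / \<alpha> * v e"
  have sqrt: "sqrt (Im \<tau>') = s'" and Im: "Im \<tau>' > 0" using s' by (simp_all add: \<tau>'_def)
  have "\<alpha> * (1 / s) + \<beta> * 0 = 1 / s'" "\<alpha> * (Re \<tau> / s) + \<beta> * s = Re \<tau>' / s'"
    using s assms by (simp_all add: s'_def \<tau>'_def field_simps)
  then have "vertex_fun ?u (1 / sqrt (Im \<tau>')) (Re \<tau>' / sqrt (Im \<tau>'))"
    using vertex_fun_linear[OF u v, of \<alpha> \<beta>] by (simp add: sqrt)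
  moreover have "vertex_fun ?v 0 (sqrt (Im \<tau>'))"
    using vertex_fun_linear[OF u v, of 0 "1 / \<alpha>"] by (simp add: sqrt s'_def)
  ultimately obtain h' where h': "straight_line_map U \<gamma>1 \<gamma>2 \<tau>' h'"
      "dirichlet_energy U p c h' = (energy_form ?u ?u + energy_form ?v ?v) / 2"
    by (rule ex_straight_line_map[OF Im])
  show ?thesis
  proof (rule that[of \<tau>' h'])
    show "(\<tau>', h') \<in> energy_domain U \<gamma>1 \<gamma>2" using h'(1) Im by (simp add: energy_domain_def)
    show "2 * dirichlet_energy U p c h' = \<alpha>\<^sup>2 * energy_form u u + 2 * \<alpha> * \<beta> * energy_form u v
      + (\<beta>\<^sup>2 + (1 / \<alpha>)\<^sup>2) * energy_form v v"
      unfolding h'(2) energy_form_sum_square by (simp add: algebra_simps)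
  qed
qed

text \<open>
  Minimality among the shears \<open>\<alpha> = 1\<close> makes \<open>u\<close> and \<open>v\<close> orthogonal, and minimality among the
  stretches \<open>\<beta> = 0\<close> makes their energies equal.
\<close>

lemma conformal_if_minimizer:
  assumes min: "energy_minimizer U p \<gamma>1 \<gamma>2 c \<tau> h" and value_k: "dirichlet_energy U p c h = k"
  shows conformal_energy
proof -
  let ?A = "energy_form u u" and ?B = "energy_form u v" and ?C = "energy_form v v"
  have sum: "?A + ?C = 2 * k" using value_k by (simp add: dirichlet_energy_h)
  have nonneg: "?A \<ge> 0" "?C \<ge> 0" using energy_form_nonneg u v by blast+
  have ineq: "?A + ?C \<le> \<alpha>\<^sup>2 * ?A + 2 * \<alpha> * \<beta> * ?B + (\<beta>\<^sup>2 + (1 / \<alpha>)\<^sup>2) * ?C"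
    if pos: "\<alpha> > 0" for \<alpha> \<beta>
  proof -
    obtain \<tau>' h' where h': "(\<tau>', h') \<in> energy_domain U \<gamma>1 \<gamma>2"
      "2 * dirichlet_energy U p c h' = \<alpha>\<^sup>2 * ?A + 2 * \<alpha> * \<beta> * ?B + (\<beta>\<^sup>2 + (1 / \<alpha>)\<^sup>2) * ?C"
      using ex_deformed_map[OF pos] by metis
    have "dirichlet_energy U p c h \<le> dirichlet_energy U p c h'"
      using min h'(1) unfolding energy_minimizer_def is_arg_min_def by force
    then show ?thesis using h'(2) dirichlet_energy_h by simp
  qed
  have "?B = 0"
  proof (rule ccontr)
    assume "?B \<noteq> 0"
    have quad: "0 \<le> 2 * \<beta> * ?B + \<beta>\<^sup>2 * ?C" for \<beta>
      using ineq[of 1 \<beta>] by (simp add: algebra_simps)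
    \<comment> \<open>the shear by \<open>- r\<close> would lower the energy; \<open>?C + 1\<close> avoids a case distinction on \<open>?C = 0\<close>\<close>
    define r where "r = ?B / (?C + 1)"
    have B: "?B = r * (?C + 1)" using nonneg by (simp add: r_def)
    have "0 \<le> - (r\<^sup>2 * (?C + 2))"
      using quad[of "- r"] unfolding B by (simp add: power2_eq_square algebra_simps)
    moreover have "r\<^sup>2 * (?C + 2) > 0"
      using \<open>?B \<noteq> 0\<close> nonneg by (intro mult_pos_pos) (auto simp: r_def)
    ultimately show False by simp
  qed
  have balance: "?A + ?C \<le> t * ?A + ?C / t" if "t > 0" for t
    using ineq[of "sqrt t" 0] that by (simp add: power_divide)
  have "?A = ?C"
  proof (rule ccontr)
    assume "?A \<noteq> ?C"
    have pos: "?A + ?C > 0" using sum k by simp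
    show False
    proof (cases "?A = 0 \<or> ?C = 0")
      case True
      then show ?thesis using balance[of 2] balance[of "1/2"] pos by auto
    next
      case False
      then have AC: "?A > 0" "?C > 0" using nonneg by auto
      \<comment> \<open>the minimum of \<open>t * ?A + ?C / t\<close>\<close>
      let ?t = "sqrt ?C / sqrt ?A"
      have "?t * ?A = sqrt ?C * sqrt ?A" "?C / ?t = sqrt ?C * sqrt ?A"
        using AC by (simp_all add: field_simps)
      then have "?A + ?C \<le> 2 * (sqrt ?A * sqrt ?C)"
        using balance[of ?t] AC by simp
      moreover have "(sqrt ?A - sqrt ?C)\<^sup>2 = ?A + ?C - 2 * (sqrt ?A * sqrt ?C)"
        using AC by (simp add: power2_diff)
      ultimately have "(sqrt ?A - sqrt ?C)\<^sup>2 \<le> 0" by simp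
      then show ?thesis using \<open>?A \<noteq> ?C\<close> by simp
    qed
  qed
  then show ?thesis using \<open>?B = 0\<close> sum by (simp add: conformal_energy_def)
qed

text \<open>
  If \<open>energy_form\<close> is \<open>k\<close> times the identity in the basis \<open>u, v\<close>, then the energy of a competitor is
  \<open>k / 2\<close> times the squared Frobenius norm of a matrix of determinant 1, plus the energy of the
  invariant remainders.  The norm is smallest exactly for rotations, and the matrix is triangular
  with positive diagonal, so that only the identity is left.
\<close>

lemma unique_minimizer_if_conformal:
  assumes E: conformal_energy
  shows "unique_energy_minimizer U p \<gamma>1 \<gamma>2 c \<tau> h" and "dirichlet_energy U p c h = k"
proof -
  show Dh: "dirichlet_energy U p c h = k"
    using E by (simp add: dirichlet_energy_h conformal_energy_def)
  have square: "\<alpha>\<^sup>2 + (\<beta>\<^sup>2 + (1 / \<alpha>)\<^sup>2) = 2 + \<beta>\<^sup>2 + (\<alpha> - 1 / \<alpha>)\<^sup>2" if "\<alpha> > 0" for \<alpha> \<beta> :: real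
    using that by (simp add: power2_diff)
  have lower: "k \<le> dirichlet_energy U p c h'" if dom: "(\<tau>', h') \<in> energy_domain U \<gamma>1 \<gamma>2" for \<tau>' h'
  proof -
    have dom': "Im \<tau>' > 0" "straight_line_map U \<gamma>1 \<gamma>2 \<tau>' h'"
      using dom by (simp_all add: energy_domain_def)
    obtain \<alpha> \<beta> g1 g2 where \<alpha>: "\<alpha> > 0" and "\<alpha> = s / sqrt (Im \<tau>')" and "\<beta> = (Re \<tau>' - Re \<tau>) / (s * sqrt (Im \<tau>'))"
      and g1: "vertex_fun g1 0 0" and g2: "vertex_fun g2 0 0"
      and "\<And>e. re_part (tail U) h' e = \<alpha> * u e + \<beta> * v e + g1 e"
      and "\<And>e. im_part (tail U) h' e = 1 / \<alpha> * v e + g2 e"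
      and D: "2 * dirichlet_energy U p c h' = \<alpha>\<^sup>2 * energy_form u u + 2 * \<alpha> * \<beta> * energy_form u v
        + (\<beta>\<^sup>2 + (1 / \<alpha>)\<^sup>2) * energy_form v v + energy_form g1 g1 + energy_form g2 g2"
      by (rule energy_decomposition[OF dom']) (rule that)
    have "2 * dirichlet_energy U p c h' = k * (\<alpha>\<^sup>2 + (\<beta>\<^sup>2 + (1 / \<alpha>)\<^sup>2)) + energy_form g1 g1 + energy_form g2 g2"
      using D E by (simp add: conformal_energy_def algebra_simps)
    moreover have "k * 2 \<le> k * (\<alpha>\<^sup>2 + (\<beta>\<^sup>2 + (1 / \<alpha>)\<^sup>2))"
      using k unfolding square[OF \<alpha>] by (intro mult_left_mono) auto
    ultimately show ?thesis
      using energy_form_nonneg[OF g1] energy_form_nonneg[OF g2] by simp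
  qed
  have h_dom: "(\<tau>, h) \<in> energy_domain U \<gamma>1 \<gamma>2"
    using \<tau> h_map by (simp add: energy_domain_def)
  have min: "energy_minimizer U p \<gamma>1 \<gamma>2 c \<tau> h"
    using lower h_dom Dh unfolding energy_minimizer_def is_arg_min_def by force
  have "\<tau>' = \<tau> \<and> (\<exists>b. \<forall>v\<in>vertices U. h' v = h v + b)"
    if min': "energy_minimizer U p \<gamma>1 \<gamma>2 c \<tau>' h'" for \<tau>' h'
  proof -
    have dom: "Im \<tau>' > 0" "straight_line_map U \<gamma>1 \<gamma>2 \<tau>' h'" and le: "dirichlet_energy U p c h' \<le> k"
      using min' h_dom Dh unfolding energy_minimizer_def is_arg_min_def energy_domain_def by force+
    obtain \<alpha> \<beta> g1 g2 where \<alpha>: "\<alpha> > 0" and \<alpha>_eq: "\<alpha> = s / sqrt (Im \<tau>')" and \<beta>: "\<beta> = (Re \<tau>' - Re \<tau>) / (s * sqrt (Im \<tau>'))"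
      and g1: "vertex_fun g1 0 0" and g2: "vertex_fun g2 0 0"
      and re: "\<And>e. re_part (tail U) h' e = \<alpha> * u e + \<beta> * v e + g1 e"
      and im: "\<And>e. im_part (tail U) h' e = 1 / \<alpha> * v e + g2 e"
      and D: "2 * dirichlet_energy U p c h' = \<alpha>\<^sup>2 * energy_form u u + 2 * \<alpha> * \<beta> * energy_form u v
        + (\<beta>\<^sup>2 + (1 / \<alpha>)\<^sup>2) * energy_form v v + energy_form g1 g1 + energy_form g2 g2"
      by (rule energy_decomposition[OF dom]) (rule that)
    have "2 * dirichlet_energy U p c h' = k * (\<alpha>\<^sup>2 + (\<beta>\<^sup>2 + (1 / \<alpha>)\<^sup>2)) + energy_form g1 g1 + energy_form g2 g2"
      using D E by (simp add: conformal_energy_def algebra_simps)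
    then have "k * (\<beta>\<^sup>2 + (\<alpha> - 1 / \<alpha>)\<^sup>2) + energy_form g1 g1 + energy_form g2 g2 \<le> 0"
      unfolding square[OF \<alpha>] using le by (simp add: algebra_simps)
    moreover have "k * (\<beta>\<^sup>2 + (\<alpha> - 1 / \<alpha>)\<^sup>2) \<ge> 0" using k by simp
    ultimately have zero: "k * (\<beta>\<^sup>2 + (\<alpha> - 1 / \<alpha>)\<^sup>2) = 0" "energy_form g1 g1 = 0" "energy_form g2 g2 = 0"
      using energy_form_nonneg[OF g1] energy_form_nonneg[OF g2] by linarith+
    then have "\<beta> = 0" "\<alpha> = 1 / \<alpha>" using k by (simp_all add: sum_power2_eq_zero_iff)
    then have "\<alpha>\<^sup>2 = 1" using \<alpha> by (simp add: power2_eq_square field_simps)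
    then have "\<alpha> = 1" using \<alpha> by (simp add: power2_eq_1_iff)
    have Im: "Im \<tau>' = Im \<tau>" using \<open>\<alpha> = 1\<close> \<alpha>_eq s dom(1) by (simp add: s_def)
    then have Re: "Re \<tau>' = Re \<tau>" using \<open>\<beta> = 0\<close> \<beta> s dom(1) by simp
    have const: "g x = g y" if "vertex_fun g 0 0" "energy_form g g = 0" for g x y
    proof (rule dart_invariant_const)
      show "g (ccw U x) = g x" "g (opp U x) = g x" for x
        using that energy_form_definite[OF that, of x] by (simp_all add: vertex_fun_def diff_def)
    qed
    \<comment> \<open>\<open>g1\<close> and \<open>g2\<close> are constant, so any dart will do\<close>
    define b where "b = Complex (g1 undefined) (g2 undefined)"
    have "h' (tail U e) = h (tail U e) + b" for e
      using re[of e] im[of e] \<open>\<alpha> = 1\<close> \<open>\<beta> = 0\<close> const[OF g1 zero(2), of e undefined]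
        const[OF g2 zero(3), of e undefined]
      by (simp add: complex_eq_iff b_def u_def v_def re_part_def im_part_def)
    then show ?thesis using Im Re by (auto simp: complex_eq_iff vertices_def)
  qed
  then show "unique_energy_minimizer U p \<gamma>1 \<gamma>2 c \<tau> h"
    using min unfolding unique_energy_minimizer_def by blast
qed

end

theorem theorem7p3:
  fixes G :: "('d::finite) cmap" and U :: "'e cmap" and p :: "'e \<Rightarrow> 'd"
    and \<gamma>1 \<gamma>2 :: "'e \<Rightarrow> 'e" and c :: "'d \<Rightarrow> real"
    and \<tau> :: complex and h :: "'e set \<Rightarrow> complex" and k :: real
  assumes "torus_decomposition G"
    and "universal_cover G U p"
    and "positive_generators G U p \<gamma>1 \<gamma>2"
    and "edge_weight G c"
    and "nondegenerate G c"
    and "Im \<tau> > 0"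
    and "straight_line_map U \<gamma>1 \<gamma>2 \<tau> h"
    and "harmonic U p c h"
    and "k > 0"
  shows "(unique_energy_minimizer U p \<gamma>1 \<gamma>2 c \<tau> h \<and> dirichlet_energy U p c h = k) \<longleftrightarrow>
         (\<exists>hc. conjugate_map U p c h hc \<and> projects_to U \<gamma>1 \<gamma>2 k \<tau> hc)"
proof -
  interpret harmonic_torus_map G U p \<gamma>1 \<gamma>2 c \<tau> h k
    using assms by unfold_locales (auto simp: torus_decomposition_def)
  show ?thesis
    using conjugate_projects_iff conformal_if_minimizer unique_minimizer_if_conformal
    unfolding unique_energy_minimizer_def by blast
qed

end
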